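(* Let $|q|<1$ and $a,b,c,d,u,v,\alpha\in\mathbb{C}$, and suppose there are no zero factors in the denominator of the integral below. Then \[ \int_u^v\frac{(qx/u,qx/v,\alpha ax;q)_\infty}{(ax,bx,cx,dx;q)_\infty}\,d_qx =\frac{(1-q)v(q,u/v,qv/u,cduv;q)_\infty}{(cu,cv,du,dv;q)_\infty}\sum_{n=0}^\infty\frac{W_n(c,d,u,v|q)\,\Phi^{(\alpha)}_n(a,b|q)}{(q;q)_n}. \]
   Context: $(a;q)_n=\prod_{k=0}^{n-1}(1-aq^k)$, $(a;q)_\infty=\prod_{k\ge0}(1-aq^k)$, $(a_1,\ldots,a_m;q)_n=(a_1;q)_n\cdots(a_m;q)_n$; ${n\brack k}_q=\frac{(q;q)_n}{(q;q)_k(q;q)_{n-k}}$. The Jackson $q$-integral is $\int_a^b f(x)\,d_qx=(1-q)\sum_{n=0}^\infty[bf(bq^n)-af(aq^n)]q^n$. The homogeneous Hahn polynomials are $\Phi^{(\alpha)}_n(x,y|q)=\sum_{k=0}^n{n\brack k}_q(\alpha;q)_kx^ky^{n-k}$, and $W_n(a,b,u,v|q)=\sum_{j=0}^n{n\brack j}_q\frac{(av,bv;q)_j}{(abuv;q)_j}u^jv^{n-j}$.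
   Formalization: The identity is stated for nonzero u, v, no vanishing factor 1 − cduv q^k (so that W_n is defined), and whenever the series on the right converges (it can diverge, e.g. for |au| > 1); convergence is proved when |au|, |av|, |bu|, |bv| < 1. *)

theory Defs
  imports "HOL-Analysis.Analysis"
begin

definition qpoch :: "complex \<Rightarrow> complex \<Rightarrow> nat \<Rightarrow> complex" where
  "qpoch a q n = (\<Prod>k<n. 1 - a * q ^ k)"

definition qpoch_inf :: "complex \<Rightarrow> complex \<Rightarrow> complex" where
  "qpoch_inf a q = (\<Prod>k. 1 - a * q ^ k)"

definition qpochs :: "complex list \<Rightarrow> complex \<Rightarrow> nat \<Rightarrow> complex" where
  "qpochs as q n = (\<Prod>a\<leftarrow>as. qpoch a q n)"

definition qpochs_inf :: "complex list \<Rightarrow> complex \<Rightarrow> complex" where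
  "qpochs_inf as q = (\<Prod>a\<leftarrow>as. qpoch_inf a q)"

definition qbinom :: "complex \<Rightarrow> nat \<Rightarrow> nat \<Rightarrow> complex" where
  "qbinom q n k = qpoch q q n / (qpoch q q k * qpoch q q (n - k))"

definition jackson_integral ::
    "complex \<Rightarrow> complex \<Rightarrow> complex \<Rightarrow> (complex \<Rightarrow> complex) \<Rightarrow> complex" where
  "jackson_integral q a b f =
     (1 - q) * (\<Sum>n. (b * f (b * q ^ n) - a * f (a * q ^ n)) * q ^ n)"

text \<open>The points at which the Jackson integral from \<open>a\<close> to \<open>b\<close> evaluates its integrand.\<close>

definition jackson_nodes :: "complex \<Rightarrow> complex \<Rightarrow> complex \<Rightarrow> complex set" where
  "jackson_nodes q a b = range (\<lambda>n::nat. a * q ^ n) \<union> range (\<lambda>n::nat. b * q ^ n)"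

definition hom_hahn :: "complex \<Rightarrow> nat \<Rightarrow> complex \<Rightarrow> complex \<Rightarrow> complex \<Rightarrow> complex" where
  "hom_hahn \<alpha> n x y q = (\<Sum>k\<le>n. qbinom q n k * qpoch \<alpha> q k * x ^ k * y ^ (n - k))"

text \<open>Meaningful only if no factor \<open>1 - a * b * u * v * q ^ k\<close> with \<open>k < n\<close> vanishes.\<close>

definition hahn_W ::
    "nat \<Rightarrow> complex \<Rightarrow> complex \<Rightarrow> complex \<Rightarrow> complex \<Rightarrow> complex \<Rightarrow> complex" where
  "hahn_W n a b u v q =
     (\<Sum>j\<le>n. qbinom q n j * (qpochs [a * v, b * v] q j / qpoch (a * b * u * v) q j)
              * u ^ j * v ^ (n - j))"

end

(* Write w(x) for the weight (qx/u, qx/v)_oo / (cx, dx)_oo and M_n for the n-th moment of w under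
   the Jackson integral from u to v.  The q-difference of x^n (x/u, x/v)_oo / (cx, dx)_oo has
   integral zero, which is a three-term recurrence for the moments; W_n satisfies the same
   recurrence by a telescoping argument, so M_n = W_n M_0.  The case n = 0 of the recurrence also
   relates M_0 at (cq, d) to M_0 at (c, d), so iterating it removes c, then d, and leaves
   M_0 at (0, 0), which is found from the choice c = q/u, d = q/v, where w is constant
   (the Andrews-Askey integral).

   The q-binomial theorem gives the generating function (alpha a x)_oo / (ax, bx)_oo of the
   polynomials Phi_n/(q)_n, and integrating termwise proves the identity when |au|, |av|, |bu|, |bv|
   are small.  In general replace (a, b) by (sa, sb), which multiplies the n-th term of the series
   by s^n.  After multiplication by (asu, asv, bsu, bsv)_oo both sides are holomorphic in |s| < 1,
   hence agree there, and Abel's limit theorem at s = 1 applies whenever the series converges. *)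

theory Submission
  imports Defs "HOL-Complex_Analysis.Complex_Analysis"
begin

section \<open>Finite q-shifted factorials, Jackson sums and moments\<close>

lemma qpoch_0 [simp]: "qpoch a q 0 = 1"
  by (simp add: qpoch_def)

lemma qpoch_Suc: "qpoch a q (Suc n) = qpoch a q n * (1 - a * q ^ n)"
  by (simp add: qpoch_def mult.commute)

lemma qpoch_add: "qpoch a q (m + n) = qpoch a q m * qpoch (a * q ^ m) q n"
  by (induction n) (auto simp: qpoch_Suc power_add mult_ac)

lemma qpoch_nonzero: "(\<And>k. 1 - a * q ^ k \<noteq> 0) \<Longrightarrow> qpoch a q n \<noteq> 0"
  by (simp add: qpoch_def)

text \<open>Up to the factor \<open>1 - q\<close> this is the Jackson integral from 0 to
  \<open>z\<close>; leaving that factor out keeps the recurrences for the moments free of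
  it.\<close>

definition jackson_sum :: "complex \<Rightarrow> complex \<Rightarrow> (complex \<Rightarrow> complex) \<Rightarrow> complex" where
  "jackson_sum q z f = (\<Sum>n. z * q ^ n * f (z * q ^ n))"

definition jackson_weight :: "complex \<Rightarrow> complex \<Rightarrow> complex \<Rightarrow> complex \<Rightarrow> complex \<Rightarrow> complex \<Rightarrow> complex" where
  "jackson_weight u v c d q x =
     qpochs_inf [q * x / u, q * x / v] q / qpochs_inf [c * x, d * x] q"

definition jackson_moment :: "complex \<Rightarrow> complex \<Rightarrow> complex \<Rightarrow> complex \<Rightarrow> complex \<Rightarrow> nat \<Rightarrow> complex" where
  "jackson_moment u v c d q k =
     jackson_sum q v (\<lambda>x. x ^ k * jackson_weight u v c d q x) -
     jackson_sum q u (\<lambda>x. x ^ k * jackson_weight u v c d q x)"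

lemma qpochs_inf_Nil [simp]: "qpochs_inf [] q = 1"
  by (simp add: qpochs_inf_def)

lemma qpochs_inf_Cons [simp]: "qpochs_inf (a # as) q = qpoch_inf a q * qpochs_inf as q"
  by (simp add: qpochs_inf_def)

lemma qpochs_Nil [simp]: "qpochs [] q n = 1"
  by (simp add: qpochs_def)

lemma qpochs_Cons [simp]: "qpochs (a # as) q n = qpoch a q n * qpochs as q n"
  by (simp add: qpochs_def)

lemma jackson_weight_commute: "jackson_weight u v c d q x = jackson_weight u v d c q x"
  by (simp add: jackson_weight_def mult.commute)

lemma jackson_moment_commute: "jackson_moment u v c d q k = jackson_moment u v d c q k"
  by (simp add: jackson_moment_def jackson_weight_commute[of u v c])

subsection \<open>Abel's limit theorem and elementary estimates\<close>

text \<open>Summation by parts writes the power series as its sum at 1 plus \<open>1 - x\<close>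
  times a power series whose coefficients, the errors of the partial sums, tend to 0. This handles
  the boundary value 1 of the scaling parameter, where only \<open>summable t\<close> is
  assumed.\<close>

lemma Abel_limit:
  fixes t :: "nat \<Rightarrow> complex"
  assumes t: "summable t"
  shows "((\<lambda>x::real. \<Sum>n. t n * of_real x ^ n) \<longlongrightarrow> suminf t) (at_left 1)"
proof (rule Lim_transform_eventually[OF _ eventually_at_left_real[of 0 1, THEN eventually_mono]])
  define D where "D n = sum t {..n} - suminf t" for n
  have D: "D \<longlonglongrightarrow> 0"
    unfolding D_def using summable_LIMSEQ'[OF t] by (simp add: LIM_zero)
  then obtain K where K: "\<And>n. norm (D n) \<le> K"
    using convergent_imp_Bseq[OF convergentI[OF D]] by (auto simp: Bseq_def)
  have K0: "0 \<le> K" using order_trans[OF norm_ge_zero K] .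
  have geo: "summable (\<lambda>n. norm (D n) * x ^ n)" if "0 < x" "x < 1" for x :: real
  proof (rule summable_comparison_test')
    show "summable (\<lambda>n. K * x ^ n)"
      using that by (intro summable_mult summable_geometric) auto
    show "norm (norm (D n) * x ^ n) \<le> K * x ^ n" for n
      using that K[of n] by (simp add: mult_right_mono)
  qed
  have sD: "summable (\<lambda>n. D n * of_real x ^ n)" if "0 < x" "x < 1" for x :: real
    by (rule summable_norm_cancel) (use geo[OF that] that in \<open>simp add: norm_mult norm_power\<close>)
  \<comment> \<open>Summation by parts, based on \<open>D (Suc n) - D n = t (Suc n)\<close>.\<close>
  show "(1 - of_real x) * (\<Sum>n. D n * of_real x ^ n) + suminf t = (\<Sum>n. t n * of_real x ^ n)"
    if "x \<in> {0<..<1}" for x :: real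
  proof -
    define y where "y = complex_of_real x"
    have y: "norm y < 1" using that by (simp add: y_def)
    have sD': "summable (\<lambda>n. D n * y ^ n)" using sD that by (simp add: y_def)
    have st: "summable (\<lambda>n. t n * y ^ n)"
      using powser_inside[of t 1 y] t y by simp
    have "(\<Sum>n. D n * y ^ n) = D 0 + (\<Sum>n. D (Suc n) * y ^ Suc n)"
      using suminf_split_head[OF sD'] by simp
    moreover have "(\<Sum>n. t n * y ^ n) = t 0 + (\<Sum>n. t (Suc n) * y ^ Suc n)"
      using suminf_split_head[OF st] by simp
    moreover have "(\<Sum>n. D (Suc n) * y ^ Suc n) - (\<Sum>n. t (Suc n) * y ^ Suc n) = y * (\<Sum>n. D n * y ^ n)"
    proof -
      have "(\<Sum>n. D (Suc n) * y ^ Suc n) - (\<Sum>n. t (Suc n) * y ^ Suc n) =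
          (\<Sum>n. D (Suc n) * y ^ Suc n - t (Suc n) * y ^ Suc n)"
        using sD' st by (intro suminf_diff) (simp_all only: summable_Suc_iff[of "\<lambda>n. D n * y ^ n"] summable_Suc_iff[of "\<lambda>n. t n * y ^ n"])
      also have "\<dots> = (\<Sum>n. y * (D n * y ^ n))"
        by (intro suminf_cong) (simp add: D_def algebra_simps)
      also have "\<dots> = y * (\<Sum>n. D n * y ^ n)"
        using sD' by (rule suminf_mult)
      finally show ?thesis .
    qed
    moreover have "D 0 = t 0 - suminf t" by (simp add: D_def)
    ultimately show ?thesis
      unfolding y_def[symmetric] by (simp add: algebra_simps)
  qed
  have "((\<lambda>x::real. (1 - of_real x) * (\<Sum>n. D n * of_real x ^ n)) \<longlongrightarrow> 0) (at_left 1)"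
  proof (rule tendstoI)
    fix e :: real assume e: "0 < e"
    then obtain N where N: "\<And>n. n \<ge> N \<Longrightarrow> norm (D n) < e / 2"
      using LIMSEQ_D[OF D, of "e / 2"] by auto
    \<comment> \<open>Within this distance of 1, the first \<open>N\<close> coefficients, each at
      most \<open>K\<close>, contribute less than \<open>e / 2\<close> after multiplication by
      \<open>1 - x\<close>; the \<open>+ 1\<close> keeps the denominator positive.\<close>
    define \<delta> where "\<delta> = e / (2 * (real N * K + 1))"
    have NK: "0 < real N * K + 1" using K0 by (simp add: add_nonneg_pos)
    have \<delta>: "0 < \<delta>" using e NK by (simp add: \<delta>_def)
    have "dist ((1 - of_real x) * (\<Sum>n. D n * of_real x ^ n)) 0 < e"
      if x: "max 0 (1 - \<delta>) < x" "x < 1" for x :: real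
    proof -
      have x0: "0 < x" using x by simp
      have xn: "x ^ n \<le> 1" for n using x x0 by (intro power_le_one) auto
      have gx: "summable (\<lambda>n. x ^ n)" using x x0 by (intro summable_geometric) auto
      have "norm (\<Sum>n. D n * of_real x ^ n) \<le> (\<Sum>n. norm (D n) * x ^ n)"
        using summable_norm[of "\<lambda>n. D n * of_real x ^ n"] geo[OF x0 x(2)] x0
        by (simp add: norm_mult norm_power)
      also have "\<dots> \<le> (\<Sum>n. (if n < N then K else 0) + e / 2 * x ^ n)"
      proof (rule suminf_le[OF _ geo[OF x0 x(2)]])
        show "norm (D n) * x ^ n \<le> (if n < N then K else 0) + e / 2 * x ^ n" for n
        proof (cases "n < N")
          case True
          have "norm (D n) * x ^ n \<le> K * 1"
            using K[of n] xn[of n] x0 K0 by (intro mult_mono) auto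
          then show ?thesis using True e x0 by (simp add: add_increasing2)
        next
          case False
          then show ?thesis using N[of n] x0 by (simp add: mult_right_mono)
        qed
        show "summable (\<lambda>n. (if n < N then K else 0) + e / 2 * x ^ n)"
          by (rule summable_add[OF summable_finite[of "{..<N}"] summable_mult[OF gx]]) auto
      qed
      also have "\<dots> = (\<Sum>n. if n < N then K else 0) + e / 2 * (\<Sum>n. x ^ n)"
      proof -
        have "summable (\<lambda>n. if n < N then K else 0)"
          by (rule summable_finite[of "{..<N}"]) auto
        then show ?thesis
          by (simp only: suminf_add[symmetric] summable_mult[OF gx] suminf_mult[OF gx, symmetric])
      qed
      also have "(\<Sum>n. if n < N then K else 0) = real N * K"
        by (subst suminf_finite[of "{..<N}"]) auto
      also have "(\<Sum>n. x ^ n) = 1 / (1 - x)"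
        using x x0 by (intro suminf_geometric) auto
      finally have "(1 - x) * norm (\<Sum>n. D n * of_real x ^ n) \<le> (1 - x) * (real N * K + e / 2 * (1 / (1 - x)))"
        using x by (intro mult_left_mono) auto
      also have "\<dots> = (1 - x) * (real N * K) + e / 2"
        using x by (simp add: field_simps)
      also have "(1 - x) * (real N * K) \<le> (1 - x) * (real N * K + 1)"
        using x by (intro mult_left_mono) auto
      also have "(1 - x) * (real N * K + 1) < \<delta> * (real N * K + 1)"
        using x NK by (intro mult_strict_right_mono) auto
      also have "\<delta> * (real N * K + 1) = e / 2"
        using NK by (simp add: \<delta>_def field_simps)
      finally have "(1 - x) * norm (\<Sum>n. D n * of_real x ^ n) < e" by simp
      moreover have "norm (1 - complex_of_real x) = 1 - x"
        using x norm_of_real[of "1 - x", where ?'a = complex] by simp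
      ultimately show ?thesis by (simp add: norm_mult)
    qed
    then show "\<forall>\<^sub>F x in at_left 1. dist ((1 - complex_of_real x) * (\<Sum>n. D n * of_real x ^ n)) 0 < e"
      using eventually_at_left_real[of "max 0 (1 - \<delta>)" 1] \<delta> by (auto elim!: eventually_mono)
  qed
  from tendsto_add[OF this tendsto_const, of "suminf t"]
  show "((\<lambda>x::real. (1 - of_real x) * (\<Sum>n. D n * of_real x ^ n) + suminf t) \<longlongrightarrow> suminf t) (at_left 1)"
    by simp
qed simp

text \<open>Comparison with the second derivative of the geometric series, whose coefficients are
  \<open>(n + 1) * (n + 2)\<close>. The square is there because the bounds for \<open>hahn_W\<close>
  and \<open>hom_hahn\<close> contribute one factor \<open>n + 1\<close> each.\<close>

lemma summable_square_geometric:
  fixes r :: real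
  assumes "0 \<le> r" "r < 1"
  shows "summable (\<lambda>n. (real n + 1)\<^sup>2 * r ^ n)"
proof -
  have 0: "summable (\<lambda>n. 1 * x ^ n)" if "norm x < 1" for x :: real
    using that by (simp add: summable_geometric)
  have 1: "summable (\<lambda>n. diffs (\<lambda>_. 1) n * x ^ n)" if "norm x < 1" for x :: real
    by (rule termdiff_converges[OF that 0])
  have "summable (\<lambda>n. diffs (diffs (\<lambda>_. 1)) n * r ^ n)"
    by (rule termdiff_converges[of r 1]) (use assms 1 in auto)
  then show ?thesis
  proof (rule summable_comparison_test')
    show "norm ((real n + 1)\<^sup>2 * r ^ n) \<le> diffs (diffs (\<lambda>_. 1)) n * r ^ n" for n
      using assms by (auto simp: diffs_def power2_eq_square intro!: mult_right_mono mult_mono)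
  qed
qed

text \<open>Each of the \<open>n + 1\<close> terms is at most \<open>K * A ^ n\<close>. Both
  \<open>hahn_W\<close> and \<open>hom_hahn\<close> have this shape with bounded
  coefficients.\<close>

lemma norm_sum_powers_le:
  fixes f :: "nat \<Rightarrow> nat \<Rightarrow> complex"
  assumes "\<And>k. k \<le> n \<Longrightarrow> norm (f n k) \<le> K" "norm x \<le> A" "norm y \<le> A"
  shows "norm (\<Sum>k\<le>n. f n k * x ^ k * y ^ (n - k)) \<le> K * (real n + 1) * A ^ n"
proof -
  have A: "0 \<le> A" using order_trans[OF norm_ge_zero assms(2)] .
  have K: "0 \<le> K" using order_trans[OF norm_ge_zero assms(1)[of 0]] by simp
  have "norm (\<Sum>k\<le>n. f n k * x ^ k * y ^ (n - k)) \<le> (\<Sum>k\<le>n. K * A ^ n)"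
  proof (rule sum_norm_le)
    fix k assume k: "k \<in> {..n}"
    have "norm (f n k * x ^ k * y ^ (n - k)) \<le> K * A ^ k * A ^ (n - k)"
      unfolding norm_mult norm_power using assms k A K
      by (intro mult_mono power_mono) auto
    also have "\<dots> = K * A ^ n" using k by (simp flip: power_add)
    finally show "norm (f n k * x ^ k * y ^ (n - k)) \<le> K * A ^ n" .
  qed
  then show ?thesis by (simp add: algebra_simps)
qed

text \<open>Homogeneity of degree \<open>n\<close>: scaling both parameters by \<open>s\<close>
  makes the series of the theorem a power series in \<open>s\<close>.\<close>

lemma hom_hahn_scale: "hom_hahn \<alpha> n (a * s) (b * s) q = s ^ n * hom_hahn \<alpha> n a b q"
  unfolding hom_hahn_def sum_distrib_left
proof (intro sum.cong refl)
  fix k assume "k \<in> {..n}"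
  then have "s ^ n = s ^ k * s ^ (n - k)" by (simp flip: power_add)
  then show "qbinom q n k * qpoch \<alpha> q k * (a * s) ^ k * (b * s) ^ (n - k) =
      s ^ n * (qbinom q n k * qpoch \<alpha> q k * a ^ k * b ^ (n - k))"
    by (simp add: power_mult_distrib mult_ac)
qed

context
  fixes q :: complex
  assumes q: "norm q < 1"
begin

subsection \<open>Infinite $q$-shifted factorials\<close>

lemma convergent_prod_qpoch: "convergent_prod (\<lambda>k. 1 - a * q ^ k)"
proof -
  have "summable (\<lambda>k. norm (1 - a * q ^ k - 1))"
    using q by (simp add: norm_mult norm_power summable_mult summable_geometric)
  then show ?thesis
    using abs_convergent_prod_conv_summable abs_convergent_prod_imp_convergent_prod by blast
qed

lemma qpoch_tendsto_inf: "(\<lambda>n. qpoch a q n) \<longlonglongrightarrow> qpoch_inf a q"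
  unfolding qpoch_def qpoch_inf_def
  using convergent_prod_qpoch has_prod_imp_tendsto' by blast

lemma qpoch_inf_split: "qpoch_inf a q = qpoch a q n * qpoch_inf (a * q ^ n) q"
proof (rule LIMSEQ_unique)
  show "(\<lambda>m. qpoch a q (n + m)) \<longlonglongrightarrow> qpoch_inf a q"
    using LIMSEQ_ignore_initial_segment[OF qpoch_tendsto_inf, of a n] by (simp add: add.commute)
  show "(\<lambda>m. qpoch a q (n + m)) \<longlonglongrightarrow> qpoch a q n * qpoch_inf (a * q ^ n) q"
    unfolding qpoch_add by (intro tendsto_intros qpoch_tendsto_inf)
qed

lemma qpoch_inf_rec: "qpoch_inf a q = (1 - a) * qpoch_inf (a * q) q"
  using qpoch_inf_split[of a 1] by (simp add: qpoch_Suc)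

lemma qpoch_inf_nonzero: "(\<And>k. 1 - a * q ^ k \<noteq> 0) \<Longrightarrow> qpoch_inf a q \<noteq> 0"
  unfolding qpoch_inf_def by (intro prodinf_nonzero convergent_prod_qpoch)

lemma qpoch_inf_eq_0: "1 - a * q ^ k = 0 \<Longrightarrow> qpoch_inf a q = 0"
  using qpoch_inf_split[of a "Suc k"] by (simp add: qpoch_Suc)

lemma qpoch_inf_0 [simp]: "qpoch_inf 0 q = 1"
  by (simp add: qpoch_inf_def)

lemma power_q_neq_1: "n > 0 \<Longrightarrow> 1 - q ^ n \<noteq> 0"
  using q power_less_one_iff[of "norm q" n] by (auto simp flip: norm_power)

lemma power_q_Suc_neq_1: "1 - q * q ^ n \<noteq> 0"
  using power_q_neq_1[of "Suc n"] by simp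

lemma qpoch_q_nonzero [simp]: "qpoch q q n \<noteq> 0"
  by (intro qpoch_nonzero power_q_Suc_neq_1)

lemma factor_nonzero_if_small: "norm z < 1 \<Longrightarrow> 1 - z * q ^ k \<noteq> 0"
proof
  assume z: "norm z < 1" and "1 - z * q ^ k = 0"
  then have "norm (z * q ^ k) = 1" by simp
  moreover have "norm (z * q ^ k) \<le> norm z * 1"
    unfolding norm_mult norm_power using q by (intro mult_left_mono power_le_one) auto
  ultimately show False using z by simp
qed

text \<open>From \<open>1 + t \<le> exp t\<close> and the geometric series. The bound is uniform in
  \<open>n\<close> and in \<open>a\<close> on a disc, as is needed to dominate the terms of
  \<open>cleared_sum\<close>.\<close>

lemma norm_qpoch_le:
  assumes "norm a \<le> A"
  shows "norm (qpoch a q n) \<le> exp (A / (1 - norm q))"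
proof -
  have A: "0 \<le> A" using assms norm_ge_zero[of a] by linarith
  have "norm (qpoch a q n) \<le> (\<Prod>k<n. norm (1 - a * q ^ k))"
    unfolding qpoch_def by (rule norm_prod_le)
  also have "\<dots> \<le> (\<Prod>k<n. 1 + A * norm q ^ k)"
  proof (intro prod_mono conjI norm_ge_zero)
    fix k
    have "norm (1 - a * q ^ k) \<le> 1 + norm a * norm q ^ k"
      using norm_triangle_ineq4[of 1 "a * q ^ k"] by (simp add: norm_mult norm_power)
    also have "\<dots> \<le> 1 + A * norm q ^ k"
      using assms by (simp add: mult_right_mono)
    finally show "norm (1 - a * q ^ k) \<le> 1 + A * norm q ^ k" .
  qed
  also have "\<dots> \<le> exp (\<Sum>k<n. A * norm q ^ k)"
    using A by (intro prod_le_exp_sum) auto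
  also have "(\<Sum>k<n. A * norm q ^ k) \<le> (\<Sum>k. A * norm q ^ k)"
    using q A by (intro sum_le_suminf summable_mult summable_geometric) auto
  also have "\<dots> = A / (1 - norm q)"
    using q by (subst suminf_mult) (auto simp: suminf_geometric summable_geometric)
  finally show ?thesis by simp
qed

lemma norm_qpoch_inf_le:
  assumes "norm a \<le> A"
  shows "norm (qpoch_inf a q) \<le> exp (A / (1 - norm q))"
  using norm_qpoch_le[OF assms] tendsto_norm[OF qpoch_tendsto_inf[of a]]
  by (meson LIMSEQ_le_const2)

text \<open>The partial products are polynomials in \<open>a\<close>, and they converge uniformly on
  every closed disc of radius 1 by the Weierstrass test.\<close>

lemma qpoch_inf_entire: "(\<lambda>a. qpoch_inf a q) holomorphic_on UNIV"
proof (rule holomorphic_uniform_sequence)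
  show "(\<lambda>a. qpoch a q n) holomorphic_on UNIV" for n
    unfolding qpoch_def by (intro holomorphic_intros)
  fix x :: complex
  have "uniformly_convergent_on (cball x 1) (\<lambda>n a. qpoch a q n)"
    unfolding qpoch_def
  proof (rule uniformly_convergent_on_prod')
    show "uniformly_convergent_on (cball x 1) (\<lambda>N a. \<Sum>n<N. norm (1 - a * q ^ n - 1))"
    proof (rule Weierstrass_m_test')
      show "norm (norm (1 - a * q ^ n - 1)) \<le> (norm x + 1) * norm q ^ n"
        if "a \<in> cball x 1" for n a
      proof -
        have "norm a \<le> norm x + 1"
          using that norm_triangle_ineq2[of a x] by (simp add: dist_norm norm_minus_commute)
        then show ?thesis by (simp add: norm_mult norm_power mult_right_mono)
      qed
      show "summable (\<lambda>n. (norm x + 1) * norm q ^ n)"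
        using q by (intro summable_mult summable_geometric) auto
    qed
  qed (auto intro!: continuous_intros)
  then obtain g where g: "uniform_limit (cball x 1) (\<lambda>n a. qpoch a q n) g sequentially"
    by (auto simp: uniformly_convergent_on_def)
  have "g a = qpoch_inf a q" if "a \<in> cball x 1" for a
    using LIMSEQ_unique[OF tendsto_uniform_limitI[OF g that] qpoch_tendsto_inf] .
  then have "uniform_limit (cball x 1) (\<lambda>n a. qpoch a q n) (\<lambda>a. qpoch_inf a q) sequentially"
    using uniform_limit_cong'[of "cball x 1" "\<lambda>n a. qpoch a q n" "\<lambda>n a. qpoch a q n" g "\<lambda>a. qpoch_inf a q"] g
    by fast
  then show "\<exists>d>0. cball x d \<subseteq> UNIV \<and>
      uniform_limit (cball x d) (\<lambda>n a. qpoch a q n) (\<lambda>a. qpoch_inf a q) sequentially"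
    by (intro exI[of _ 1]) auto
qed auto

lemma holomorphic_on_qpoch_inf [holomorphic_intros]:
  "f holomorphic_on A \<Longrightarrow> (\<lambda>s. qpoch_inf (f s) q) holomorphic_on A"
  using holomorphic_on_compose_gen[OF _ qpoch_inf_entire, of f A] by (simp add: o_def)

lemma tendsto_qpoch_inf [tendsto_intros]:
  assumes "(f \<longlongrightarrow> l) F"
  shows "((\<lambda>x. qpoch_inf (f x) q) \<longlongrightarrow> qpoch_inf l q) F"
proof -
  have "isCont (\<lambda>a. qpoch_inf a q) l"
    using holomorphic_on_imp_continuous_on[OF qpoch_inf_entire] continuous_on_eq_continuous_at
    by blast
  then show ?thesis using assms isCont_tendsto_compose by blast
qed

lemma node_tendsto_0: "(\<lambda>n. z * q ^ n) \<longlonglongrightarrow> 0"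
  using q by (auto intro: tendsto_mult_right_zero LIMSEQ_power_zero)

subsection \<open>Jackson sums and moments\<close>

text \<open>The factor \<open>z * q ^ n\<close> decays geometrically, so boundedness along the orbit
  gives absolute convergence.\<close>

lemma summable_jackson_sum:
  assumes "Bseq (\<lambda>n. f (z * q ^ n))"
  shows "summable (\<lambda>n. norm (z * q ^ n * f (z * q ^ n)))"
proof -
  obtain K where K: "\<And>n. norm (f (z * q ^ n)) \<le> K"
    using assms by (auto simp: Bseq_def)
  show ?thesis
  proof (rule summable_comparison_test')
    show "summable (\<lambda>n. norm z * K * norm q ^ n)"
      using q by (intro summable_mult summable_geometric) auto
    show "norm (norm (z * q ^ n * f (z * q ^ n))) \<le> norm z * K * norm q ^ n" for n
      using mult_left_mono[OF K[of n], of "norm z * norm q ^ n"]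
      by (simp add: norm_mult norm_power mult_ac)
  qed
qed

lemma jackson_sum_sums:
  assumes "Bseq (\<lambda>n. f (z * q ^ n))"
  shows "(\<lambda>n. z * q ^ n * f (z * q ^ n)) sums jackson_sum q z f"
  unfolding jackson_sum_def
  by (intro summable_sums summable_norm_cancel[OF summable_jackson_sum] assms)

text \<open>All four infinite products tend to \<open>qpoch_inf 0 q\<close>, which is 1. In
  particular the weight is bounded on each orbit \<open>z * q ^ n\<close>.\<close>

lemma jackson_weight_tendsto_1:
  assumes "(f \<longlongrightarrow> 0) F"
  shows "((\<lambda>n. jackson_weight u v c d q (f n)) \<longlongrightarrow> 1) F"
proof -
  have "((\<lambda>n. jackson_weight u v c d q (f n)) \<longlongrightarrow> jackson_weight u v c d q 0) F"
    unfolding jackson_weight_def qpochs_inf_Cons qpochs_inf_Nil divide_inverse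
    by (intro tendsto_intros tendsto_qpoch_inf assms) (use qpoch_inf_0 in auto)
  then show ?thesis using q by (simp add: jackson_weight_def)
qed

lemma Bseq_jackson_weight:
  "Bseq (\<lambda>n. (z * q ^ n) ^ k * jackson_weight u v c d q (z * q ^ n))"
proof (rule convergent_imp_Bseq, rule convergentI)
  show "(\<lambda>n. (z * q ^ n) ^ k * jackson_weight u v c d q (z * q ^ n)) \<longlonglongrightarrow> 0 ^ k * 1"
    by (intro tendsto_mult tendsto_power jackson_weight_tendsto_1 node_tendsto_0)
qed

text \<open>For \<open>k = 0\<close> the first term on the right vanishes, so truncated subtraction is harmless.\<close>

lemma weight_difference:
  fixes c d u v :: complex
  defines "F \<equiv> \<lambda>k x. x ^ k * qpochs_inf [x / u, x / v] q / qpochs_inf [c * x, d * x] q"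
  defines "w \<equiv> jackson_weight u v c d q"
  assumes "1 - c * x \<noteq> 0" "1 - d * x \<noteq> 0" "u \<noteq> 0" "v \<noteq> 0"
  shows "F k x - F k (x * q) =
      (1 - q ^ k) * (x * (x ^ (k - 1) * w x)) +
      (q ^ k * (c + d) - (1 / u + 1 / v)) * (x * (x ^ k * w x)) +
      (1 / (u * v) - q ^ k * (c * d)) * (x * (x ^ Suc k * w x))"
proof -
  \<comment> \<open>Both values of \<open>F\<close> are polynomial multiples of \<open>w x\<close>:
    \<open>F k x\<close> has the extra leading factors \<open>1 - x / u\<close> and
    \<open>1 - x / v\<close> in the numerator, while \<open>F k (x * q)\<close> lacks the factors
    \<open>1 - c * x\<close> and \<open>1 - d * x\<close> in the denominator.\<close>
  have "F k x = x ^ k * ((1 - x / u) * (1 - x / v)) * w x * (1 / ((1 - c * x) * (1 - d * x))) * ((1 - c * x) * (1 - d * x))"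
    unfolding F_def w_def jackson_weight_def
    using assms(3,4) qpoch_inf_rec[of "x / u"] qpoch_inf_rec[of "x / v"]
    by (simp add: mult_ac)
  also have "\<dots> = x ^ k * ((1 - x / u) * (1 - x / v)) * w x"
    using assms(3,4) by simp
  finally have 1: "F k x = x ^ k * ((1 - x / u) * (1 - x / v)) * w x" .
  have 2: "F k (x * q) = x ^ k * q ^ k * ((1 - c * x) * (1 - d * x)) * w x"
    unfolding F_def w_def jackson_weight_def
    using assms(3,4) qpoch_inf_rec[of "c * x"] qpoch_inf_rec[of "d * x"]
    by (simp add: power_mult_distrib mult_ac)
  have 3: "(1 - q ^ k) * (x * x ^ (k - 1)) = (1 - q ^ k) * x ^ k"
    by (cases k) auto
  have "F k x - F k (x * q) = w x * ((1 - q ^ k) * x ^ k) +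
      (q ^ k * (c + d) - (1 / u + 1 / v)) * (x * (x ^ k * w x)) +
      (1 / (u * v) - q ^ k * (c * d)) * (x * (x ^ Suc k * w x))"
    unfolding 1 2 using assms(5,6) by (simp add: field_simps)
  then show ?thesis
    unfolding 3[symmetric] by (simp add: mult_ac)
qed

text \<open>Along the orbit of \<open>z\<close> the differences of \<open>F\<close> telescope to
  \<open>F z\<close> minus its limit at 0. The limit \<open>0 ^ k\<close> is the same for
  \<open>z = u\<close> and \<open>z = v\<close>, so it cancels in the moment.\<close>

lemma jackson_moment_difference:
  assumes "\<And>z k. z \<in> {u, v} \<Longrightarrow> 1 - c * z * q ^ k \<noteq> 0 \<and> 1 - d * z * q ^ k \<noteq> 0"
  assumes "u \<noteq> 0" "v \<noteq> 0"
  shows "(1 - q ^ k) * jackson_moment u v c d q (k - 1) +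
      (q ^ k * (c + d) - (1 / u + 1 / v)) * jackson_moment u v c d q k +
      (1 / (u * v) - q ^ k * (c * d)) * jackson_moment u v c d q (Suc k) = 0"
proof -
  define w where "w = jackson_weight u v c d q"
  define S where "S z j = jackson_sum q z (\<lambda>x. x ^ j * w x)" for z j
  have "(1 - q ^ k) * S z (k - 1) + (q ^ k * (c + d) - (1 / u + 1 / v)) * S z k +
      (1 / (u * v) - q ^ k * (c * d)) * S z (Suc k) = - (0 ^ k)" if z: "z \<in> {u, v}" for z
  proof -
    define F where "F x = x ^ k * qpochs_inf [x / u, x / v] q / qpochs_inf [c * x, d * x] q" for x
    have S: "(\<lambda>n. z * q ^ n * ((z * q ^ n) ^ j * w (z * q ^ n))) sums S z j" for j
      unfolding S_def w_def by (rule jackson_sum_sums[OF Bseq_jackson_weight])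
    have "(\<lambda>n. F (z * q ^ n) - F (z * q ^ n * q)) sums
        ((1 - q ^ k) * S z (k - 1) + (q ^ k * (c + d) - (1 / u + 1 / v)) * S z k +
        (1 / (u * v) - q ^ k * (c * d)) * S z (Suc k))"
    proof (rule sums_cong[THEN iffD2])
      show "(\<lambda>n. (1 - q ^ k) * (z * q ^ n * ((z * q ^ n) ^ (k - 1) * w (z * q ^ n))) +
        (q ^ k * (c + d) - (1 / u + 1 / v)) * (z * q ^ n * ((z * q ^ n) ^ k * w (z * q ^ n))) +
        (1 / (u * v) - q ^ k * (c * d)) * (z * q ^ n * ((z * q ^ n) ^ Suc k * w (z * q ^ n)))) sums
        ((1 - q ^ k) * S z (k - 1) + (q ^ k * (c + d) - (1 / u + 1 / v)) * S z k +
        (1 / (u * v) - q ^ k * (c * d)) * S z (Suc k))"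
        by (intro sums_add sums_mult S)
      show "F (z * q ^ n) - F (z * q ^ n * q) =
        (1 - q ^ k) * (z * q ^ n * ((z * q ^ n) ^ (k - 1) * w (z * q ^ n))) +
        (q ^ k * (c + d) - (1 / u + 1 / v)) * (z * q ^ n * ((z * q ^ n) ^ k * w (z * q ^ n))) +
        (1 / (u * v) - q ^ k * (c * d)) * (z * q ^ n * ((z * q ^ n) ^ Suc k * w (z * q ^ n)))" for n
        unfolding F_def w_def using assms(1)[OF z, of n] assms(2,3)
        by (intro weight_difference) (auto simp: mult.assoc)
    qed
    moreover have "(\<lambda>n. F (z * q ^ n) - F (z * q ^ n * q)) sums (F z - 0 ^ k)"
    proof -
      have "(\<lambda>n. F (z * q ^ n)) \<longlonglongrightarrow> 0 ^ k * qpochs_inf [0 / u, 0 / v] q / qpochs_inf [c * 0, d * 0] q"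
        unfolding F_def qpochs_inf_Cons qpochs_inf_Nil using assms(2,3) qpoch_inf_0
        by (intro tendsto_intros tendsto_qpoch_inf node_tendsto_0) simp_all
      then have "(\<lambda>n. F (z * q ^ n)) \<longlonglongrightarrow> 0 ^ k"
        using q by simp
      from telescope_sums'[OF this] show ?thesis by (simp add: mult_ac)
    qed
    \<comment> \<open>One of \<open>z / u\<close> and \<open>z / v\<close> equals 1, and
      \<open>qpoch_inf 1 q\<close> has a vanishing first factor.\<close>
    moreover have "F z = 0"
      using z assms(2,3) qpoch_inf_eq_0[of 1 0] by (auto simp: F_def)
    ultimately show ?thesis using sums_unique2 by fastforce
  qed
  then have "(1 - q ^ k) * S v (k - 1) + (q ^ k * (c + d) - (1 / u + 1 / v)) * S v k +
      (1 / (u * v) - q ^ k * (c * d)) * S v (Suc k) =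
      (1 - q ^ k) * S u (k - 1) + (q ^ k * (c + d) - (1 / u + 1 / v)) * S u k +
      (1 / (u * v) - q ^ k * (c * d)) * S u (Suc k)"
    by simp
  moreover have "jackson_moment u v c d q j = S v j - S u j" for j
    by (simp add: jackson_moment_def S_def w_def)
  ultimately show ?thesis
    by (simp only: right_diff_distrib) (simp add: algebra_simps)
qed

lemma jackson_moment_rec:
  assumes "\<And>z k. z \<in> {u, v} \<Longrightarrow> 1 - c * z * q ^ k \<noteq> 0 \<and> 1 - d * z * q ^ k \<noteq> 0"
  assumes "u \<noteq> 0" "v \<noteq> 0"
  shows "(1 - c * d * u * v * q ^ k) * jackson_moment u v c d q (Suc k) =
      (u + v - q ^ k * (c + d) * u * v) * jackson_moment u v c d q k -
      u * v * (1 - q ^ k) * jackson_moment u v c d q (k - 1)"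
proof -
  define A B C where "A = jackson_moment u v c d q (Suc k)" and "B = jackson_moment u v c d q k"
    and "C = jackson_moment u v c d q (k - 1)"
  have "(1 - q ^ k) * C + (q ^ k * (c + d) - (1 / u + 1 / v)) * B + (1 / (u * v) - q ^ k * (c * d)) * A = 0"
    using jackson_moment_difference[OF assms] unfolding A_def B_def C_def .
  then have "u * v * ((1 - q ^ k) * C + (q ^ k * (c + d) - (1 / u + 1 / v)) * B + (1 / (u * v) - q ^ k * (c * d)) * A) = 0"
    by simp
  \<comment> \<open>The reciprocals are abstracted to \<open>P\<close> and \<open>Q\<close>, so that
    the expansion is a polynomial identity; their values are inserted afterwards.\<close>
  moreover have "u * v * ((1 - q ^ k) * C + (q ^ k * (c + d) - P) * B + (Q - q ^ k * (c * d)) * A) =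
      u * v * (1 - q ^ k) * C + (q ^ k * (c + d) * u * v - u * v * P) * B + (u * v * Q - c * d * u * v * q ^ k) * A" for P Q
    by (simp add: algebra_simps)
  moreover have "u * v * (1 / u + 1 / v) = u + v" "u * v * (1 / (u * v)) = 1"
    using assms(2,3) by (simp_all add: field_simps)
  ultimately have "u * v * (1 - q ^ k) * C + (q ^ k * (c + d) * u * v - (u + v)) * B + (1 - c * d * u * v * q ^ k) * A = 0"
    by metis
  then show ?thesis
    unfolding A_def[symmetric] B_def[symmetric] C_def[symmetric] by (simp add: algebra_simps)
qed

subsection \<open>The recurrence for $W_n$\<close>

text \<open>\<open>qbinom q n k\<close> does not vanish for \<open>k > n\<close>.\<close>

definition qbinom_ext :: "nat \<Rightarrow> nat \<Rightarrow> complex" where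
  "qbinom_ext n k = (if k \<le> n then qbinom q n k else 0)"

lemma qbinom_ext_0 [simp]: "qbinom_ext n 0 = 1"
  using q by (simp add: qbinom_ext_def qbinom_def)

text \<open>For \<open>i \<ge> n\<close> both sides vanish: the left one by the extension by 0, the
  right one because \<open>n - i\<close> truncates to 0.\<close>

lemma qbinom_ext_Suc_right:
  "qbinom_ext n (Suc i) = qbinom_ext n i * (1 - q ^ (n - i)) / (1 - q ^ Suc i)"
proof (cases "i < n")
  case True
  then obtain m where n: "n = i + Suc m" by (metis less_iff_Suc_add add_Suc_right)
  then have "n - i = Suc m" "n - Suc i = m" by auto
  then show ?thesis
    using True power_q_Suc_neq_1[of m]
    by (simp add: qbinom_ext_def qbinom_def qpoch_Suc)
qed (auto simp: qbinom_ext_def)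

lemma qbinom_ext_Suc_Suc:
  assumes "i \<le> n"
  shows "qbinom_ext (Suc n) (Suc i) = qbinom_ext n i * (1 - q ^ Suc n) / (1 - q ^ Suc i)"
  using assms by (simp add: qbinom_ext_def qbinom_def qpoch_Suc)

lemma qbinom_ext_pred:
  assumes "i \<le> n"
  shows "(1 - q ^ n) * qbinom_ext (n - 1) i = (1 - q ^ (n - i)) * qbinom_ext n i"
proof (cases "i < n")
  case True
  then obtain m k where n: "n - i = Suc m" "n - 1 - i = m" "n = Suc k"
    by (metis Suc_diff_Suc Suc_diff_1 diff_Suc_Suc diff_zero less_nat_zero_code not0_implies_Suc diff_commute diff_Suc_1)
  then show ?thesis
    using True power_q_Suc_neq_1[of m] power_q_Suc_neq_1[of k]
    by (simp add: qbinom_ext_def qbinom_def qpoch_Suc)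
next
  case False
  with assms show ?thesis by (cases n) (auto simp: qbinom_ext_def)
qed

text \<open>A common summation range lets polynomials of neighbouring degrees be combined term by
  term.\<close>

lemma hahn_W_ext:
  assumes "n \<le> N"
  shows "hahn_W n c d u v q =
    (\<Sum>j\<le>N. qbinom_ext n j * (qpochs [c * v, d * v] q j / qpoch (c * d * u * v) q j) * u ^ j * v ^ (n - j))"
  unfolding hahn_W_def using assms
  by (intro sum.mono_neutral_cong_left) (auto simp: qbinom_ext_def)

text \<open>Creative telescoping: the combination of the summands prescribed by the moment
  recurrence is a difference \<open>H j - H (Suc j)\<close> whose boundary terms vanish.\<close>

lemma hahn_W_rec:
  assumes "\<And>k. 1 - c * d * u * v * q ^ k \<noteq> 0"
  shows "(1 - c * d * u * v * q ^ n) * hahn_W (Suc n) c d u v q =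
      (u + v - q ^ n * (c + d) * u * v) * hahn_W n c d u v q -
      u * v * (1 - q ^ n) * hahn_W (n - 1) c d u v q"
proof -
  define C where "C = c * d * u * v"
  define B where "B j = qpochs [c * v, d * v] q j / qpoch C q j" for j
  have B_0: "B 0 = 1" by (simp add: B_def)
  have B_Suc: "(1 - C * q ^ i) * B (Suc i) = (1 - c * v * q ^ i) * (1 - d * v * q ^ i) * B i" for i
    using assms[of i, folded C_def] by (simp add: B_def qpoch_Suc)
  \<comment> \<open>\<open>T\<close> and \<open>T'\<close> are the summands of
    \<open>u * hahn_W n\<close> and \<open>u * v * hahn_W (n - 1)\<close>, shifted by one index so
    that all terms carry \<open>u ^ j\<close>; \<open>H\<close> is the telescoping
    certificate.\<close>
  define T where "T j = (case j of 0 \<Rightarrow> 0 | Suc i \<Rightarrow> qbinom_ext n i * B i * u ^ j * v ^ (n - i))" for j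
  define T' where "T' j = (case j of 0 \<Rightarrow> 0 | Suc i \<Rightarrow> qbinom_ext (n - 1) i * B i * u ^ j * v ^ (n - i))" for j
  define H where "H j = (case j of 0 \<Rightarrow> 0 | Suc i \<Rightarrow> q ^ n * (c * d * v\<^sup>2) * q ^ i * qbinom_ext n i * B i * u ^ j * v ^ (n - i))" for j
  have W: "hahn_W m c d u v q = (\<Sum>j\<le>N. qbinom_ext m j * B j * u ^ j * v ^ (m - j))" if "m \<le> N" for m N
    using hahn_W_ext[OF that] by (simp add: B_def C_def)
  have vW: "v * hahn_W n c d u v q = (\<Sum>j\<le>Suc n. qbinom_ext n j * B j * u ^ j * v ^ (Suc n - j))"
    unfolding W[of n "Suc n", OF le_SucI[OF order_refl]] sum_distrib_left
    by (intro sum.cong refl) (auto simp: qbinom_ext_def Suc_diff_le)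
  have uW: "u * hahn_W n c d u v q = (\<Sum>j\<le>Suc n. T j)"
    unfolding W[OF order_refl] sum_distrib_left sum.atMost_Suc_shift
    by (simp add: T_def mult_ac)
  have uvW: "(1 - q ^ n) * (u * v * hahn_W (n - 1) c d u v q) = (\<Sum>j\<le>Suc n. (1 - q ^ n) * T' j)"
  proof (cases n)
    case (Suc m)
    have "m \<le> n" using Suc by simp
    then have "u * v * hahn_W m c d u v q = (\<Sum>j\<le>n. T' (Suc j))"
      unfolding W[OF \<open>m \<le> n\<close>] sum_distrib_left
      by (intro sum.cong refl) (auto simp: T'_def Suc qbinom_ext_def Suc_diff_le)
    also have "\<dots> = (\<Sum>j\<le>Suc n. T' j)"
      unfolding sum.atMost_Suc_shift by (simp add: T'_def)
    finally have "u * v * hahn_W m c d u v q = (\<Sum>j\<le>Suc n. T' j)" .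
    then show ?thesis by (simp only: Suc diff_Suc_1 sum_distrib_left)
  qed simp
  have main: "(1 - C * q ^ n) * (qbinom_ext (Suc n) j * B j * u ^ j * v ^ (Suc n - j)) -
      qbinom_ext n j * B j * u ^ j * v ^ (Suc n - j) - T j + q ^ n * (c + d) * v * T j + (1 - q ^ n) * T' j
      = H j - H (Suc j)" if "j \<le> Suc n" for j
  proof (cases j)
    case 0
    then show ?thesis by (simp add: T_def T'_def H_def B_0 C_def power2_eq_square algebra_simps)
  next
    case (Suc i)
    with that have i: "i \<le> n" by simp
    define x y \<beta> V where "x = q ^ i" and "y = q ^ (n - i)" and "\<beta> = qbinom_ext n i" and "V = v ^ (n - i)"
    have qn: "q ^ n = x * y" using i by (simp add: x_def y_def flip: power_add)
    \<comment> \<open>The only quotient gets a name and is used through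
      \<open>e * (1 - q * x) = 1\<close>, so that what remains is polynomial algebra.\<close>
    define e where "e = 1 / (1 - q * x)"
    have e: "e * (1 - q * x) = 1"
      using power_q_Suc_neq_1[of i] by (simp add: e_def x_def)
    have b1: "qbinom_ext n j = \<beta> * (1 - y) * e"
      by (simp add: Suc qbinom_ext_Suc_right \<beta>_def y_def e_def x_def)
    have b2: "qbinom_ext (Suc n) j = \<beta> * (1 - x * y * q) * e"
      using i by (simp add: Suc qbinom_ext_Suc_Suc \<beta>_def e_def x_def[symmetric] qn mult_ac)
    have b3: "(1 - q ^ n) * T' j = (1 - y) * \<beta> * B i * u ^ j * V"
      using qbinom_ext_pred[OF i] by (simp add: T'_def Suc \<beta>_def y_def V_def)
    have T: "T j = \<beta> * B i * u ^ j * V"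
      by (simp add: T_def Suc \<beta>_def V_def)
    have H: "H j = x * y * (c * d * v\<^sup>2) * x * \<beta> * B i * u ^ j * V"
      by (simp add: H_def Suc \<beta>_def V_def qn x_def[symmetric])
    \<comment> \<open>For \<open>i = n\<close> the subtraction \<open>n - j\<close> truncates, but
      then \<open>y = 1\<close> and the factor \<open>1 - y\<close> removes the term.\<close>
    have "v * (\<beta> * (1 - y) * e) * v ^ (n - j) = \<beta> * (1 - y) * e * V"
    proof (cases "i = n")
      case False
      with i have "n - i = Suc (n - j)" using Suc by simp
      then show ?thesis by (simp add: V_def)
    qed (simp add: y_def)
    moreover have "H (Suc j) = x * y * (c * d * v) * (q * x) * B j * (u * u ^ j) * (v * (\<beta> * (1 - y) * e) * v ^ (n - j))"
      unfolding b1[symmetric] by (simp add: H_def qn power2_eq_square x_def Suc)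
    ultimately have H': "H (Suc j) = x * y * C * (q * x) * B j * u ^ j * (\<beta> * (1 - y) * e * V)"
      by (simp add: C_def)
    have Bj: "(1 - C * x) * B j = (1 - c * v * x) * (1 - d * v * x) * B i"
      using B_Suc[of i] by (simp add: Suc x_def)
    \<comment> \<open>This identity makes the certificate work: \<open>1 - q * x\<close> cancels
      against \<open>e\<close>, and \<open>1 - C * x\<close> turns \<open>B j\<close> into a
      multiple of \<open>B i\<close>.\<close>
    have "(1 - C * (x * y)) * (1 - x * y * q) - (1 - y) + x * y * C * (q * x) * (1 - y) = y * (1 - q * x) * (1 - C * x)"
      by (simp add: algebra_simps)
    then have "((1 - C * (x * y)) * (1 - x * y * q) - (1 - y) + x * y * C * (q * x) * (1 - y)) * e * B j =
        (e * (1 - q * x)) * (y * ((1 - C * x) * B j))"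
      by (simp add: mult_ac)
    then have *: "((1 - C * (x * y)) * (1 - x * y * q) - (1 - y) + x * y * C * (q * x) * (1 - y)) * e * B j =
        y * (1 - c * v * x) * (1 - d * v * x) * B i"
      by (simp add: e Bj mult.assoc)
    have Vj: "v ^ (Suc n - j) = V" by (simp add: V_def Suc)
    have "(1 - C * (x * y)) * (\<beta> * (1 - x * y * q) * e * B j * u ^ j * V) - \<beta> * (1 - y) * e * B j * u ^ j * V
        + x * y * C * (q * x) * B j * u ^ j * (\<beta> * (1 - y) * e * V)
        = \<beta> * u ^ j * V * (((1 - C * (x * y)) * (1 - x * y * q) - (1 - y) + x * y * C * (q * x) * (1 - y)) * e * B j)"
      by (simp add: algebra_simps)
    also have "\<dots> = \<beta> * u ^ j * V * (y * (1 - c * v * x) * (1 - d * v * x) * B i)"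
      unfolding * ..
    finally show ?thesis
      unfolding b1 b2 b3[unfolded qn] T H H' qn Vj by (simp add: algebra_simps power2_eq_square)
  qed
  have "(\<Sum>j\<le>Suc n. (1 - C * q ^ n) * (qbinom_ext (Suc n) j * B j * u ^ j * v ^ (Suc n - j)) -
      qbinom_ext n j * B j * u ^ j * v ^ (Suc n - j) - T j + q ^ n * (c + d) * v * T j + (1 - q ^ n) * T' j)
      = (\<Sum>j\<le>Suc n. H j - H (Suc j))"
    by (intro sum.cong refl main) auto
  also have "\<dots> = H 0 - H (Suc (Suc n))"
    by (rule sum_telescope)
  \<comment> \<open>\<open>H 0\<close> is 0 by definition, and \<open>H (Suc (Suc n))\<close>
    contains \<open>qbinom_ext n (Suc n)\<close>.\<close>
  also have "\<dots> = 0"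
    by (simp add: H_def qbinom_ext_def)
  finally have "(1 - C * q ^ n) * hahn_W (Suc n) c d u v q - v * hahn_W n c d u v q - u * hahn_W n c d u v q
      + q ^ n * (c + d) * v * (u * hahn_W n c d u v q) + (1 - q ^ n) * (u * v * hahn_W (n - 1) c d u v q) = 0"
    unfolding sum.distrib sum_subtractf sum_distrib_left[symmetric] vW[symmetric] uW[symmetric]
      W[OF order_refl, of "Suc n", symmetric] uvW[symmetric, unfolded sum_distrib_left[symmetric]] .
  then show ?thesis
    unfolding C_def by (simp add: algebra_simps)
qed

lemma hahn_W_0 [simp]: "hahn_W 0 c d u v q = 1"
  using q by (simp add: hahn_W_def qbinom_def)

text \<open>Both sides satisfy the same recurrence and agree at \<open>n = 0\<close>; the leading
  coefficient is nonzero by the hypothesis on \<open>c * d * u * v\<close>.\<close>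

lemma jackson_moment_eq_hahn_W:
  assumes "\<And>z k. z \<in> {u, v} \<Longrightarrow> 1 - c * z * q ^ k \<noteq> 0 \<and> 1 - d * z * q ^ k \<noteq> 0"
  assumes "u \<noteq> 0" "v \<noteq> 0" and C: "\<And>k. 1 - c * d * u * v * q ^ k \<noteq> 0"
  shows "jackson_moment u v c d q n = hahn_W n c d u v q * jackson_moment u v c d q 0"
proof (induction n rule: less_induct)
  case (less n)
  show ?case
  proof (cases n)
    case (Suc m)
    let ?M = "jackson_moment u v c d q" and ?W = "\<lambda>n. hahn_W n c d u v q"
    \<comment> \<open>For \<open>m = 0\<close> the index \<open>m - 1\<close> is again 0, still
      below \<open>n\<close>, and its coefficient \<open>1 - q ^ m\<close> is 0.\<close>
    have IH: "?M m = ?W m * ?M 0" "?M (m - 1) = ?W (m - 1) * ?M 0"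
      by (rule less.IH, use Suc in simp)+
    have "(1 - c * d * u * v * q ^ m) * ?M (Suc m) =
        ((u + v - q ^ m * (c + d) * u * v) * ?W m - u * v * (1 - q ^ m) * ?W (m - 1)) * ?M 0"
    proof (subst jackson_moment_rec)
      show "1 - c * z * q ^ k \<noteq> 0 \<and> 1 - d * z * q ^ k \<noteq> 0" if "z \<in> {u, v}" for z k
        using assms(1) that by blast
      show "(u + v - q ^ m * (c + d) * u * v) * ?M m - u * v * (1 - q ^ m) * ?M (m - 1) =
        ((u + v - q ^ m * (c + d) * u * v) * ?W m - u * v * (1 - q ^ m) * ?W (m - 1)) * ?M 0"
        unfolding IH by (simp add: algebra_simps)
    qed (use assms in auto)
    also have "\<dots> = (1 - c * d * u * v * q ^ m) * (?W (Suc m) * ?M 0)"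
      unfolding hahn_W_rec[OF C, symmetric] by (simp only: mult.assoc)
    finally show ?thesis
      unfolding Suc using C[of m] by (simp only: mult_cancel_left) simp
  qed simp
qed

subsection \<open>The Andrews--Askey integral\<close>

lemma jackson_sum_diff_mult:
  assumes "Bseq (\<lambda>n. f (z * q ^ n))" "Bseq (\<lambda>n. g (z * q ^ n))"
    and "\<And>n. h (z * q ^ n) = f (z * q ^ n) - c * g (z * q ^ n)"
  shows "jackson_sum q z h = jackson_sum q z f - c * jackson_sum q z g"
proof -
  have "(\<lambda>n. z * q ^ n * f (z * q ^ n) - c * (z * q ^ n * g (z * q ^ n))) sums
      (jackson_sum q z f - c * jackson_sum q z g)"
    by (intro sums_diff sums_mult jackson_sum_sums assms)
  then show ?thesis
    unfolding jackson_sum_def[of q z h] assms(3) by (simp add: sums_iff algebra_simps)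
qed

lemma Bseq_jackson_weight_0: "Bseq (\<lambda>n. jackson_weight u v c d q (z * q ^ n))"
  using Bseq_jackson_weight[of z 0] by simp

text \<open>Replacing \<open>c\<close> by \<open>c * q\<close> multiplies the weight by
  \<open>1 - c * x\<close>, so the new zeroth moment is the old one minus \<open>c\<close> times the
  first. The recurrence at \<open>k = 0\<close> eliminates the first moment.\<close>

lemma jackson_moment_q_shift:
  assumes nz: "\<And>z k. z \<in> {u, v} \<Longrightarrow> 1 - c * z * q ^ k \<noteq> 0 \<and> 1 - d * z * q ^ k \<noteq> 0"
    and uv: "u \<noteq> 0" "v \<noteq> 0"
  shows "(1 - c * d * u * v) * jackson_moment u v (c * q) d q 0 =
    (1 - c * u) * (1 - c * v) * jackson_moment u v c d q 0"
proof -
  let ?M = "jackson_moment u v c d q"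
  have "jackson_sum q z (\<lambda>x. x ^ 0 * jackson_weight u v (c * q) d q x) =
      jackson_sum q z (\<lambda>x. x ^ 0 * jackson_weight u v c d q x) -
      c * jackson_sum q z (\<lambda>x. x ^ 1 * jackson_weight u v c d q x)" if z: "z \<in> {u, v}" for z
  proof (rule jackson_sum_diff_mult)
    fix n
    define x where "x = z * q ^ n"
    have "qpoch_inf (c * x) q = (1 - c * x) * qpoch_inf (c * q * x) q" "1 - c * x \<noteq> 0"
      using qpoch_inf_rec[of "c * x"] nz[OF z, of n] by (auto simp: x_def mult_ac)
    then have "inverse (qpoch_inf (c * q * x) q) = (1 - c * x) * inverse (qpoch_inf (c * x) q)"
      by simp
    then show "x ^ 0 * jackson_weight u v (c * q) d q x =
        x ^ 0 * jackson_weight u v c d q x - c * (x ^ 1 * jackson_weight u v c d q x)"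
      by (simp only: jackson_weight_def divide_inverse qpochs_inf_Cons qpochs_inf_Nil
          inverse_mult_distrib) (simp add: algebra_simps)
  qed (use Bseq_jackson_weight[of z 0] Bseq_jackson_weight[of z 1] in simp_all)
  from this[of u] this[of v] have "jackson_moment u v (c * q) d q 0 = ?M 0 - c * ?M 1"
    by (simp add: jackson_moment_def right_diff_distrib)
  moreover have "(1 - c * d * u * v) * ?M 1 = (u + v - (c + d) * u * v) * ?M 0"
    using jackson_moment_rec[OF nz uv, of 0] by simp
  ultimately have "(1 - c * d * u * v) * jackson_moment u v (c * q) d q 0 =
      (1 - c * d * u * v) * ?M 0 - c * ((u + v - (c + d) * u * v) * ?M 0)"
    by (simp add: right_diff_distrib mult.left_commute[of _ c])
  also have "\<dots> = (1 - c * u) * (1 - c * v) * ?M 0"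
    by (simp add: algebra_simps)
  finally show ?thesis .
qed

lemma jackson_moment_q_shift_iterate:
  assumes nz: "\<And>z k. z \<in> {u, v} \<Longrightarrow> 1 - c * z * q ^ k \<noteq> 0 \<and> 1 - d * z * q ^ k \<noteq> 0"
    and uv: "u \<noteq> 0" "v \<noteq> 0"
  shows "qpoch (c * d * u * v) q n * jackson_moment u v (c * q ^ n) d q 0 =
    qpoch (c * u) q n * qpoch (c * v) q n * jackson_moment u v c d q 0"
proof (induction n)
  case (Suc n)
  have "(1 - c * q ^ n * d * u * v) * jackson_moment u v (c * q ^ n * q) d q 0 =
      (1 - c * q ^ n * u) * (1 - c * q ^ n * v) * jackson_moment u v (c * q ^ n) d q 0"
  proof (rule jackson_moment_q_shift[OF _ uv])
    fix z k assume "z \<in> {u, v}"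
    from nz[OF this, of "n + k"] nz[OF this, of k]
    show "1 - c * q ^ n * z * q ^ k \<noteq> 0 \<and> 1 - d * z * q ^ k \<noteq> 0"
      by (simp add: power_add mult_ac)
  qed
  then have "qpoch (c * d * u * v) q n * ((1 - c * d * u * v * q ^ n) * jackson_moment u v (c * q ^ Suc n) d q 0) =
      (1 - c * u * q ^ n) * (1 - c * v * q ^ n) * (qpoch (c * d * u * v) q n * jackson_moment u v (c * q ^ n) d q 0)"
    by (simp add: mult_ac)
  then show ?case
    unfolding Suc.IH qpoch_Suc by (simp add: mult_ac)
qed simp

text \<open>Tannery's theorem: termwise limits under a geometric majorant.\<close>

lemma jackson_sum_weight_tendsto:
  "(\<lambda>n. jackson_sum q z (jackson_weight u v (c * q ^ n) d q)) \<longlonglongrightarrow>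
     jackson_sum q z (jackson_weight u v 0 d q)"
proof -
  \<comment> \<open>At the node \<open>z * q ^ k\<close> the parameter \<open>c * q ^ n\<close>
    enters only through \<open>c * z * q ^ (k + n)\<close>. Hence one convergent sequence
    \<open>h\<close> supplies both the termwise limits and the uniform bound.\<close>
  define h where "h j = inverse (qpoch_inf (c * z * q ^ j) q)" for j
  have h_lim: "h \<longlonglongrightarrow> inverse 1"
    unfolding h_def using tendsto_qpoch_inf[OF node_tendsto_0[of "c * z"]] q
    by (intro tendsto_inverse) auto
  obtain K where K: "\<And>j. norm (h j) \<le> K"
    using convergent_imp_Bseq[OF convergentI[OF h_lim]] by (auto simp: Bseq_def)
  obtain L where L: "\<And>k. norm (jackson_weight u v 0 d q (z * q ^ k)) \<le> L"
    using Bseq_jackson_weight_0[of u v 0 d z] by (auto simp: Bseq_def)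
  have w: "jackson_weight u v (c * q ^ n) d q (z * q ^ k) = jackson_weight u v 0 d q (z * q ^ k) * h (k + n)" for n k
    using q by (simp add: jackson_weight_def h_def power_add divide_inverse mult_ac)
  have "(\<lambda>n. \<Sum>k. z * q ^ k * jackson_weight u v (c * q ^ n) d q (z * q ^ k)) \<longlonglongrightarrow>
      (\<Sum>k. z * q ^ k * jackson_weight u v 0 d q (z * q ^ k))"
  proof (rule tannerys_theorem[THEN conjunct2, THEN conjunct2])
    show "(\<lambda>n. z * q ^ k * jackson_weight u v (c * q ^ n) d q (z * q ^ k)) \<longlonglongrightarrow>
        z * q ^ k * jackson_weight u v 0 d q (z * q ^ k)" for k
      using LIMSEQ_ignore_initial_segment[OF h_lim, of k] unfolding w
      by (auto intro!: tendsto_eq_intros simp: add.commute)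
    show "summable (\<lambda>k. norm z * (L * K) * norm q ^ k)"
      using q by (intro summable_mult summable_geometric) auto
    have "norm (z * q ^ k * jackson_weight u v (c * q ^ n) d q (z * q ^ k)) \<le> norm z * (L * K) * norm q ^ k" for k n
    proof -
      have "norm (jackson_weight u v 0 d q (z * q ^ k)) * norm (h (k + n)) \<le> L * K"
        using K L by (intro mult_mono) (auto intro: order_trans[OF norm_ge_zero])
      from mult_left_mono[OF this, of "norm z * norm q ^ k"] show ?thesis
        by (simp add: w norm_mult norm_power mult_ac)
    qed
    then show "\<forall>\<^sub>F (k, n) in sequentially \<times>\<^sub>F sequentially.
        norm (z * q ^ k * jackson_weight u v (c * q ^ n) d q (z * q ^ k)) \<le> norm z * (L * K) * norm q ^ k"
      by (intro always_eventually) auto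
  qed auto
  then show ?thesis by (simp add: jackson_sum_def)
qed

text \<open>The limit of the iterated shift, which sends \<open>c * q ^ n\<close> to 0.\<close>

lemma jackson_moment_0_reduce:
  assumes nz: "\<And>z k. z \<in> {u, v} \<Longrightarrow> 1 - c * z * q ^ k \<noteq> 0 \<and> 1 - d * z * q ^ k \<noteq> 0"
    and uv: "u \<noteq> 0" "v \<noteq> 0"
  shows "qpoch_inf (c * u) q * qpoch_inf (c * v) q * jackson_moment u v c d q 0 =
    qpoch_inf (c * d * u * v) q * jackson_moment u v 0 d q 0"
proof (rule LIMSEQ_unique)
  have eq: "qpoch (c * u) q n * qpoch (c * v) q n * jackson_moment u v c d q 0 =
      qpoch (c * d * u * v) q n * jackson_moment u v (c * q ^ n) d q 0" for n
    using jackson_moment_q_shift_iterate[OF nz uv] by simp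
  show "(\<lambda>n. qpoch (c * u) q n * qpoch (c * v) q n * jackson_moment u v c d q 0) \<longlonglongrightarrow>
      qpoch_inf (c * u) q * qpoch_inf (c * v) q * jackson_moment u v c d q 0"
    by (intro tendsto_mult qpoch_tendsto_inf tendsto_const)
  show "(\<lambda>n. qpoch (c * u) q n * qpoch (c * v) q n * jackson_moment u v c d q 0) \<longlonglongrightarrow>
      qpoch_inf (c * d * u * v) q * jackson_moment u v 0 d q 0"
    unfolding eq unfolding jackson_moment_def power_0 mult_1
    by (intro tendsto_mult tendsto_diff qpoch_tendsto_inf jackson_sum_weight_tendsto)
qed

text \<open>By the symmetry in \<open>c\<close> and \<open>d\<close>, a second reduction removes
  \<open>d\<close> with 0 as the other parameter; its product factor is then
  \<open>qpoch_inf 0 q = 1\<close>.\<close>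

lemma jackson_moment_0_reduce_both:
  assumes nz: "\<And>z k. z \<in> {u, v} \<Longrightarrow> 1 - c * z * q ^ k \<noteq> 0 \<and> 1 - d * z * q ^ k \<noteq> 0"
    and uv: "u \<noteq> 0" "v \<noteq> 0"
  shows "qpochs_inf [c * u, c * v, d * u, d * v] q * jackson_moment u v c d q 0 =
    qpoch_inf (c * d * u * v) q * jackson_moment u v 0 0 q 0"
proof -
  have "qpoch_inf (d * u) q * qpoch_inf (d * v) q * jackson_moment u v 0 d q 0 = jackson_moment u v 0 0 q 0"
    using jackson_moment_0_reduce[of u v d 0] nz uv q by (simp add: jackson_moment_commute[of u v 0 d])
  moreover have "qpochs_inf [c * u, c * v, d * u, d * v] q * jackson_moment u v c d q 0 =
      qpoch_inf (d * u) q * qpoch_inf (d * v) q *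
      (qpoch_inf (c * u) q * qpoch_inf (c * v) q * jackson_moment u v c d q 0)"
    by (simp add: mult_ac)
  moreover have "qpoch_inf (c * u) q * qpoch_inf (c * v) q * jackson_moment u v c d q 0 =
      qpoch_inf (c * d * u * v) q * jackson_moment u v 0 d q 0"
    using jackson_moment_0_reduce[OF nz uv] by simp
  ultimately show ?thesis by (simp only: mult.left_commute)
qed

text \<open>If \<open>u\<close> lies on the $q$-orbit of \<open>v\<close>, the two Jackson sums cancel: the weight
  vanishes at the nodes \<open>v, \<dots>, v q\<^sup>m\<close> that the \<open>u\<close>-orbit misses.\<close>

lemma jackson_moment_degenerate:
  assumes u: "u = v * q ^ Suc m" and uv: "u \<noteq> 0" "v \<noteq> 0"
  shows "jackson_moment u v c d q k = 0"
proof -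
  let ?w = "jackson_weight u v c d q"
  define a where "a n = v * q ^ n * ((v * q ^ n) ^ k * ?w (v * q ^ n))" for n
  have a: "summable a"
    unfolding a_def by (intro summable_norm_cancel[OF summable_jackson_sum] Bseq_jackson_weight)
  have "a n = 0" if "n < Suc m" for n
  proof -
    have "m = n + (m - n)" using that by simp
    then have "q * (v * q ^ n) * q ^ (m - n) = u"
      unfolding u power_Suc by (metis mult.assoc mult.left_commute power_add)
    then have "1 - q * (v * q ^ n) / u * q ^ (m - n) = 0"
      using uv(1) by (simp add: field_simps)
    from qpoch_inf_eq_0[OF this] show ?thesis
      unfolding a_def jackson_weight_def by simp
  qed
  then have "(\<Sum>n. a n) = (\<Sum>n. a (n + Suc m))"
    using suminf_split_initial_segment[OF a, of "Suc m"] by simp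
  also have "\<dots> = jackson_sum q u (\<lambda>x. x ^ k * ?w x)"
    unfolding jackson_sum_def a_def u by (simp add: power_add mult_ac)
  finally show ?thesis
    by (simp add: jackson_moment_def jackson_sum_def[of q v] a_def)
qed

lemma jackson_weight_swap: "jackson_weight u v c d q x = jackson_weight v u c d q x"
  by (simp add: jackson_weight_def mult.commute)

lemma jackson_moment_swap: "jackson_moment u v c d q k = - jackson_moment v u c d q k"
  by (simp add: jackson_moment_def jackson_weight_swap[of u v])

text \<open>The reduction to parameters 0 is read backwards at \<open>c = q / u\<close>,
  \<open>d = q / v\<close>, where the weight is 1 at all nodes and the zeroth moment is a difference
  of geometric series.\<close>

lemma jackson_moment_base:
  assumes uv: "u \<noteq> 0" "v \<noteq> 0"
  shows "jackson_moment u v 0 0 q 0 = v * qpochs_inf [q, u / v, q * v / u] q"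
proof -
  \<comment> \<open>The first two cases are exactly those in which this choice of \<open>c\<close>
    and \<open>d\<close> has a zero factor in the denominator; there both sides of the claim
    vanish.\<close>
  consider (u) m where "u = v * q ^ Suc m" | (v) m where "v = u * q ^ Suc m"
    | (gen) "\<And>m. u \<noteq> v * q ^ Suc m" "\<And>m. v \<noteq> u * q ^ Suc m" by blast
  then show ?thesis
  proof cases
    case (u m)
    then have "1 - q * v / u * q ^ m = 0" using uv by simp
    from qpoch_inf_eq_0[OF this] show ?thesis
      using jackson_moment_degenerate[OF u uv] by simp
  next
    case (v m)
    then have "1 - u / v * q ^ Suc m = 0" using uv by simp
    from qpoch_inf_eq_0[OF this] show ?thesis
      using jackson_moment_degenerate[OF v uv(2,1)]
      by (simp add: jackson_moment_swap[of u v])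
  next
    case gen
    have nz: "1 - q / u * z * q ^ k \<noteq> 0 \<and> 1 - q / v * z * q ^ k \<noteq> 0" if "z \<in> {u, v}" for z k
      using that gen(1)[of k] gen(2)[of k] uv power_q_Suc_neq_1[of k] by (auto simp: field_simps)
    have w: "jackson_weight u v (q / u) (q / v) q (z * q ^ k) = 1" if z: "z \<in> {u, v}" for z k
    proof -
      have "1 - q * (z * q ^ k) / u * q ^ j \<noteq> 0 \<and> 1 - q * (z * q ^ k) / v * q ^ j \<noteq> 0" for j
        using nz[OF z, of "k + j"] by (simp add: power_add mult_ac)
      then show ?thesis
        unfolding jackson_weight_def using qpoch_inf_nonzero by (simp add: mult_ac)
    qed
    have "jackson_sum q z (\<lambda>x. x ^ 0 * jackson_weight u v (q / u) (q / v) q x) = z / (1 - q)"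
      if "z \<in> {u, v}" for z
      using w[OF that] q by (simp add: jackson_sum_def suminf_mult summable_geometric suminf_geometric)
    then have M: "jackson_moment u v (q / u) (q / v) q 0 = (v - u) / (1 - q)"
      by (simp add: jackson_moment_def diff_divide_distrib)
    have q1: "1 - q \<noteq> 0" using power_q_neq_1[of 1] by simp
    have Q: "qpoch_inf (q * q) q \<noteq> 0"
      using power_q_Suc_neq_1[of "Suc k" for k] by (intro qpoch_inf_nonzero) (simp add: mult_ac)
    \<comment> \<open>Here \<open>c * d * u * v\<close> is \<open>q * q\<close>. Splitting the first
      factor off \<open>qpoch_inf q q\<close> produces the same product, and its
      \<open>1 - q\<close> cancels against the geometric series.\<close>
    have "qpoch_inf (q / u * (q / v) * u * v) q = qpoch_inf (q * q) q"
      using uv by simp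
    moreover have "qpochs_inf [q / u * u, q / u * v, q / v * u, q / v * v] q =
        (1 - q) * qpoch_inf (q * q) q * qpoch_inf (q * v / u) q * qpoch_inf (q * u / v) q * qpoch_inf q q"
      using uv qpoch_inf_rec[of q] by simp
    moreover have "qpochs_inf [q / u * u, q / u * v, q / v * u, q / v * v] q * ((v - u) / (1 - q)) =
        qpoch_inf (q / u * (q / v) * u * v) q * jackson_moment u v 0 0 q 0"
      using jackson_moment_0_reduce_both[OF nz uv] unfolding M by blast
    ultimately have "qpoch_inf (q * q) q * jackson_moment u v 0 0 q 0 = qpoch_inf (q * q) q *
       ((v - u) * qpoch_inf (q * v / u) q * qpoch_inf (q * u / v) q * qpoch_inf q q)"
      using q1 by (simp only: times_divide_eq_right) (auto simp: mult_ac)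
    then have "jackson_moment u v 0 0 q 0 =
       (v - u) * qpoch_inf (q * v / u) q * qpoch_inf (q * u / v) q * qpoch_inf q q"
      using Q by simp
    also have "v - u = v * (1 - u / v)"
      using uv by (simp add: field_simps)
    finally show ?thesis
      using qpoch_inf_rec[of "u / v"] by (simp add: mult_ac)
  qed
qed

lemma andrews_askey:
  assumes nz: "\<And>z k. z \<in> {u, v} \<Longrightarrow> 1 - c * z * q ^ k \<noteq> 0 \<and> 1 - d * z * q ^ k \<noteq> 0"
    and uv: "u \<noteq> 0" "v \<noteq> 0"
  shows "jackson_moment u v c d q 0 =
    v * qpochs_inf [q, u / v, q * v / u, c * d * u * v] q / qpochs_inf [c * u, c * v, d * u, d * v] q"
proof -
  have "qpochs_inf [c * u, c * v, d * u, d * v] q \<noteq> 0"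
    using nz qpoch_inf_nonzero by simp
  then show ?thesis
    using jackson_moment_0_reduce_both[OF nz uv] jackson_moment_base[OF uv]
    by (simp add: field_simps)
qed

subsection \<open>Generating function of the Hahn polynomials\<close>

lemma Bseq_qpoch: "Bseq (\<lambda>n. qpoch a q n)"
  using convergent_imp_Bseq[OF convergentI[OF qpoch_tendsto_inf]] .

lemma Bseq_inverse_qpoch:
  assumes "\<And>k. 1 - a * q ^ k \<noteq> 0"
  shows "Bseq (\<lambda>n. inverse (qpoch a q n))"
  using convergent_imp_Bseq[OF convergentI[OF tendsto_inverse[OF qpoch_tendsto_inf]]]
    qpoch_inf_nonzero[OF assms] by blast

text \<open>The coefficients are bounded, since numerator and denominator converge and the limit of
  the denominator is nonzero.\<close>

lemma summable_q_binomial: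
  assumes "norm z < 1"
  shows "summable (\<lambda>n. norm (qpoch \<alpha> q n / qpoch q q n * z ^ n))"
proof -
  have "Bseq (\<lambda>n. qpoch \<alpha> q n * inverse (qpoch q q n))"
    by (intro Bseq_mult Bseq_qpoch Bseq_inverse_qpoch power_q_Suc_neq_1 q)
  then obtain K where K: "\<And>n. norm (qpoch \<alpha> q n / qpoch q q n) \<le> K"
    by (auto simp: Bseq_def divide_inverse)
  show ?thesis
  proof (rule summable_comparison_test')
    show "summable (\<lambda>n. K * norm z ^ n)"
      using assms by (intro summable_mult summable_geometric) auto
    show "norm (norm (qpoch \<alpha> q n / qpoch q q n * z ^ n)) \<le> K * norm z ^ n" for n
      using mult_right_mono[OF K[of n], of "norm z ^ n"] by (simp add: norm_mult norm_divide norm_power)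
  qed
qed

text \<open>The coefficient recurrence gives
  \<open>(1 - x) * h x = (1 - \<alpha> * x) * h (x * q)\<close>. Iteration moves the argument along
  \<open>z * q ^ n\<close> to 0, where \<open>h\<close> is continuous with value 1.\<close>

lemma q_binomial_theorem:
  assumes z: "norm z < 1"
  shows "(\<lambda>n. qpoch \<alpha> q n / qpoch q q n * z ^ n) sums (qpoch_inf (\<alpha> * z) q / qpoch_inf z q)"
proof -
  define c where "c n = qpoch \<alpha> q n / qpoch q q n" for n
  define h where "h x = (\<Sum>n. c n * x ^ n)" for x
  have sm: "summable (\<lambda>n. c n * x ^ n)" if "norm x < 1" for x
    unfolding c_def by (rule summable_norm_cancel[OF summable_q_binomial[OF that]])
  have c_Suc: "c (Suc n) * (1 - q ^ Suc n) = c n * (1 - \<alpha> * q ^ n)" for n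
    using power_q_Suc_neq_1[of n] by (simp add: c_def qpoch_Suc)
  have step: "(1 - x) * h x = (1 - \<alpha> * x) * h (x * q)" if x: "norm x < 1" for x
  proof -
    have xq: "norm (x * q) < 1"
      using x q mult_strict_mono'[of "norm x" 1 "norm q" 1] by (simp add: norm_mult)
    have "(\<lambda>n. c n * x ^ n - c n * (x * q) ^ n) sums (h x - h (x * q))"
      unfolding h_def by (intro sums_diff summable_sums sm x xq)
    \<comment> \<open>The term of index 0 is \<open>c 0 - c 0\<close>, so dropping it does not
      change the sum.\<close>
    then have "(\<lambda>n. c (Suc n) * x ^ Suc n - c (Suc n) * (x * q) ^ Suc n) sums (h x - h (x * q))"
      by (subst sums_Suc_iff) simp
    moreover have "c (Suc n) * x ^ Suc n - c (Suc n) * (x * q) ^ Suc n =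
        x * (c n * x ^ n) - \<alpha> * x * (c n * (x * q) ^ n)" for n
    proof -
      have "c (Suc n) * x ^ Suc n - c (Suc n) * (x * q) ^ Suc n = c (Suc n) * (1 - q ^ Suc n) * x ^ Suc n"
        unfolding power_mult_distrib by (simp only: algebra_simps mult_1_left)
      also have "\<dots> = x * (c n * x ^ n) - \<alpha> * x * (c n * (x * q) ^ n)"
        unfolding c_Suc by (simp add: algebra_simps power_mult_distrib)
      finally show ?thesis .
    qed
    moreover have "(\<lambda>n. x * (c n * x ^ n) - \<alpha> * x * (c n * (x * q) ^ n)) sums (x * h x - \<alpha> * x * h (x * q))"
      unfolding h_def by (intro sums_diff sums_mult summable_sums sm x xq)
    ultimately have "h x - h (x * q) = x * h x - \<alpha> * x * h (x * q)"
      by (simp add: sums_unique2)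
    then show ?thesis by (simp add: algebra_simps)
  qed
  have small: "norm (z * q ^ n) < 1" for n
  proof -
    have "norm z * norm q ^ n \<le> norm z * 1"
      using q by (intro mult_left_mono power_le_one) auto
    then show ?thesis using z by (simp add: norm_mult norm_power)
  qed
  have iter: "qpoch z q n * h z = qpoch (\<alpha> * z) q n * h (z * q ^ n)" for n
  proof (induction n)
    case (Suc n)
    have "qpoch z q (Suc n) * h z = (1 - z * q ^ n) * (qpoch z q n * h z)"
      by (simp add: qpoch_Suc)
    also have "\<dots> = qpoch (\<alpha> * z) q n * ((1 - z * q ^ n) * h (z * q ^ n))"
      unfolding Suc.IH by simp
    also have "\<dots> = qpoch (\<alpha> * z) q (Suc n) * h (z * q ^ Suc n)"
      unfolding step[OF small] by (simp add: qpoch_Suc mult_ac)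
    finally show ?case .
  qed simp
  have "isCont h 0"
    unfolding h_def[abs_def] by (rule isCont_powser[of _ "1/2"]) (auto intro!: sm)
  then have "(\<lambda>n. h (z * q ^ n)) \<longlonglongrightarrow> h 0"
    using node_tendsto_0 isCont_tendsto_compose by blast
  moreover have "h 0 = 1"
    using powser_zero[of c] by (simp add: h_def c_def)
  ultimately have "(\<lambda>n. qpoch z q n * h z) \<longlonglongrightarrow> qpoch_inf (\<alpha> * z) q * 1"
    unfolding iter by (intro tendsto_mult qpoch_tendsto_inf) simp
  moreover have "(\<lambda>n. qpoch z q n * h z) \<longlonglongrightarrow> qpoch_inf z q * h z"
    by (intro tendsto_mult qpoch_tendsto_inf tendsto_const)
  ultimately have "qpoch_inf z q * h z = qpoch_inf (\<alpha> * z) q"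
    using LIMSEQ_unique by fastforce
  moreover have "qpoch_inf z q \<noteq> 0"
    using factor_nonzero_if_small[OF z] by (rule qpoch_inf_nonzero)
  ultimately have "h z = qpoch_inf (\<alpha> * z) q / qpoch_inf z q"
    by (simp add: field_simps)
  then show ?thesis
    using summable_sums[OF sm[OF z]] by (simp add: h_def c_def)
qed

lemma qpoch_zero [simp]: "qpoch 0 q n = 1"
  by (simp add: qpoch_def)

text \<open>A Cauchy convolution of two q-binomial series. The factor
  \<open>qpoch 0 q (n - k)\<close>, equal to 1, is kept so that the second one is also an instance
  of that series.\<close>

lemma hom_hahn_Cauchy:
  "hom_hahn \<alpha> n a b q / qpoch q q n * x ^ n =
    (\<Sum>k\<le>n. (qpoch \<alpha> q k / qpoch q q k * (a * x) ^ k) *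
      (qpoch 0 q (n - k) / qpoch q q (n - k) * (b * x) ^ (n - k)))"
  unfolding hom_hahn_def sum_divide_distrib sum_distrib_right
proof (intro sum.cong refl)
  fix k assume "k \<in> {..n}"
  then have "x ^ n = x ^ k * x ^ (n - k)" by (simp flip: power_add)
  then show "qbinom q n k * qpoch \<alpha> q k * a ^ k * b ^ (n - k) / qpoch q q n * x ^ n =
      (qpoch \<alpha> q k / qpoch q q k * (a * x) ^ k) *
      (qpoch 0 q (n - k) / qpoch q q (n - k) * (b * x) ^ (n - k))"
    using q by (simp add: qbinom_def power_mult_distrib)
qed

text \<open>The product of the q-binomial series with parameters \<open>\<alpha>\<close> and 0;
  absolute convergence follows by comparison with the Cauchy product of the norms.\<close>

lemma
  assumes "norm (a * x) < 1" "norm (b * x) < 1"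
  shows summable_hom_hahn: "summable (\<lambda>n. norm (hom_hahn \<alpha> n a b q / qpoch q q n * x ^ n))"
    and hom_hahn_generating: "(\<lambda>n. hom_hahn \<alpha> n a b q / qpoch q q n * x ^ n) sums
      (qpoch_inf (\<alpha> * a * x) q / qpochs_inf [a * x, b * x] q)"
proof -
  define A where "A k = qpoch \<alpha> q k / qpoch q q k * (a * x) ^ k" for k
  define B where "B k = qpoch 0 q k / qpoch q q k * (b * x) ^ k" for k
  have *: "hom_hahn \<alpha> n a b q / qpoch q q n * x ^ n = (\<Sum>k\<le>n. A k * B (n - k))" for n
    unfolding hom_hahn_Cauchy A_def B_def ..
  have A: "summable (\<lambda>k. norm (A k))" and B: "summable (\<lambda>k. norm (B k))"
    unfolding A_def B_def by (intro summable_q_binomial assms)+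
  show "summable (\<lambda>n. norm (hom_hahn \<alpha> n a b q / qpoch q q n * x ^ n))"
    unfolding *
  proof (rule summable_comparison_test')
    show "summable (\<lambda>n. \<Sum>k\<le>n. norm (A k) * norm (B (n - k)))"
      using A B by (intro summable_Cauchy_product) simp_all
    show "norm (norm (\<Sum>k\<le>n. A k * B (n - k))) \<le> (\<Sum>k\<le>n. norm (A k) * norm (B (n - k)))" for n
      by (simp add: norm_mult[symmetric] norm_sum)
  qed
  have "(\<Sum>k. A k) = qpoch_inf (\<alpha> * (a * x)) q / qpoch_inf (a * x) q"
    using sums_unique[OF q_binomial_theorem[OF assms(1), of \<alpha>]] by (simp add: A_def)
  moreover have "(\<Sum>k. B k) = 1 / qpoch_inf (b * x) q"
    using sums_unique[OF q_binomial_theorem[OF assms(2), of 0]] q by (simp add: B_def)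
  ultimately show "(\<lambda>n. hom_hahn \<alpha> n a b q / qpoch q q n * x ^ n) sums
      (qpoch_inf (\<alpha> * a * x) q / qpochs_inf [a * x, b * x] q)"
    unfolding * using Cauchy_product_sums[OF A B] by (simp add: mult.assoc)
qed

text \<open>Interchange of the two summations by Tannery's theorem, applied to the partial sums over
  \<open>n\<close>: since \<open>norm (q ^ k) \<le> 1\<close>, they are bounded by \<open>S\<close>
  at all nodes simultaneously.\<close>

lemma jackson_sum_powser:
  assumes "summable (\<lambda>n. norm (\<phi> n * z ^ n))" and f: "Bseq (\<lambda>k. f (z * q ^ k))"
  shows "(\<lambda>n. \<phi> n * jackson_sum q z (\<lambda>x. x ^ n * f x)) sums
    jackson_sum q z (\<lambda>x. (\<Sum>n. \<phi> n * x ^ n) * f x)"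
proof -
  obtain L where L: "\<And>k. norm (f (z * q ^ k)) \<le> L"
    using f by (auto simp: Bseq_def)
  define S where "S = (\<Sum>n. norm (\<phi> n * z ^ n))"
  have le: "norm (\<phi> n * (z * q ^ k) ^ n) \<le> norm (\<phi> n * z ^ n)" for n k
  proof -
    have "norm (q ^ k) ^ n \<le> 1"
      using q by (intro power_le_one) (auto simp: norm_power intro: power_le_one)
    then show ?thesis
      using mult_left_mono[of _ 1 "norm (\<phi> n * z ^ n)"]
      by (simp add: norm_mult norm_power power_mult_distrib mult.assoc mult_left_le)
  qed
  have sm: "summable (\<lambda>n. \<phi> n * (z * q ^ k) ^ n)" for k
    using summable_comparison_test'[OF assms(1), of 0 "\<lambda>n. \<phi> n * (z * q ^ k) ^ n"] le by auto
  have part: "norm (\<Sum>n<N. \<phi> n * (z * q ^ k) ^ n) \<le> S" for N k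
  proof -
    have "norm (\<Sum>n<N. \<phi> n * (z * q ^ k) ^ n) \<le> (\<Sum>n<N. norm (\<phi> n * z ^ n))"
      by (intro sum_norm_le le)
    also have "\<dots> \<le> S"
      unfolding S_def by (intro sum_le_suminf assms(1)) auto
    finally show ?thesis .
  qed
  have "(\<lambda>N. \<Sum>k. z * q ^ k * ((\<Sum>n<N. \<phi> n * (z * q ^ k) ^ n) * f (z * q ^ k))) \<longlonglongrightarrow>
      (\<Sum>k. z * q ^ k * ((\<Sum>n. \<phi> n * (z * q ^ k) ^ n) * f (z * q ^ k)))"
  proof (rule tannerys_theorem[THEN conjunct2, THEN conjunct2])
    show "(\<lambda>N. z * q ^ k * ((\<Sum>n<N. \<phi> n * (z * q ^ k) ^ n) * f (z * q ^ k))) \<longlonglongrightarrow>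
        z * q ^ k * ((\<Sum>n. \<phi> n * (z * q ^ k) ^ n) * f (z * q ^ k))" for k
      by (intro tendsto_mult tendsto_const summable_LIMSEQ sm)
    show "summable (\<lambda>k. norm z * (S * L) * norm q ^ k)"
      using q by (intro summable_mult summable_geometric) auto
    have "norm (z * q ^ k * ((\<Sum>n<N. \<phi> n * (z * q ^ k) ^ n) * f (z * q ^ k))) \<le> norm z * (S * L) * norm q ^ k" for k N
    proof -
      have "norm (\<Sum>n<N. \<phi> n * (z * q ^ k) ^ n) * norm (f (z * q ^ k)) \<le> S * L"
        using part L by (intro mult_mono) (auto intro: order_trans[OF norm_ge_zero])
      from mult_left_mono[OF this, of "norm z * norm q ^ k"] show ?thesis
        by (simp add: norm_mult norm_power mult_ac)
    qed
    then show "\<forall>\<^sub>F (k, N) in sequentially \<times>\<^sub>F sequentially.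
        norm (z * q ^ k * ((\<Sum>n<N. \<phi> n * (z * q ^ k) ^ n) * f (z * q ^ k))) \<le> norm z * (S * L) * norm q ^ k"
      by (intro always_eventually) auto
  qed auto
  moreover have "(\<Sum>k. z * q ^ k * ((\<Sum>n<N. \<phi> n * (z * q ^ k) ^ n) * f (z * q ^ k))) =
      (\<Sum>n<N. \<phi> n * jackson_sum q z (\<lambda>x. x ^ n * f x))" for N
  proof -
    have "Bseq (\<lambda>k. (z * q ^ k) ^ n * f (z * q ^ k))" for n
      by (intro Bseq_mult f convergent_imp_Bseq[OF convergentI[OF tendsto_power[OF node_tendsto_0]]])
    then have "(\<lambda>k. \<Sum>n<N. \<phi> n * (z * q ^ k * ((z * q ^ k) ^ n * f (z * q ^ k)))) sums
        (\<Sum>n<N. \<phi> n * jackson_sum q z (\<lambda>x. x ^ n * f x))"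
      by (intro sums_sum sums_mult jackson_sum_sums)
    moreover have "(\<Sum>n<N. \<phi> n * (z * q ^ k * ((z * q ^ k) ^ n * f (z * q ^ k)))) =
        z * q ^ k * ((\<Sum>n<N. \<phi> n * (z * q ^ k) ^ n) * f (z * q ^ k))" for k
      unfolding sum_distrib_left sum_distrib_right by (intro sum.cong refl) (simp only: mult_ac)
    ultimately show ?thesis
      by (simp add: sums_iff)
  qed
  ultimately show ?thesis
    by (simp add: sums_def jackson_sum_def)
qed

lemma jackson_sum_hom_hahn:
  assumes "norm (a * z) < 1" "norm (b * z) < 1"
  shows "(\<lambda>n. hom_hahn \<alpha> n a b q / qpoch q q n * jackson_sum q z (\<lambda>x. x ^ n * jackson_weight u v c d q x)) sums
    jackson_sum q z (\<lambda>x. qpoch_inf (\<alpha> * a * x) q / qpochs_inf [a * x, b * x] q * jackson_weight u v c d q x)"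
proof -
  have "norm (e * (z * q ^ k)) < 1" if "norm (e * z) < 1" for e k
  proof -
    have "norm (e * z) * norm (q ^ k) \<le> norm (e * z) * 1"
      using q by (intro mult_left_mono) (auto simp: norm_power power_le_one)
    then show ?thesis using that by (simp add: norm_mult mult.assoc)
  qed
  then have "(\<Sum>n. hom_hahn \<alpha> n a b q / qpoch q q n * (z * q ^ k) ^ n) =
      qpoch_inf (\<alpha> * a * (z * q ^ k)) q / qpochs_inf [a * (z * q ^ k), b * (z * q ^ k)] q" for k
    using assms by (intro sums_unique[symmetric] hom_hahn_generating) auto
  then have "jackson_sum q z (\<lambda>x. (\<Sum>n. hom_hahn \<alpha> n a b q / qpoch q q n * x ^ n) * jackson_weight u v c d q x) =
      jackson_sum q z (\<lambda>x. qpoch_inf (\<alpha> * a * x) q / qpochs_inf [a * x, b * x] q * jackson_weight u v c d q x)"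
    unfolding jackson_sum_def by (simp only:)
  from this[symmetric] show ?thesis
    by (simp only: jackson_sum_powser[OF summable_hom_hahn[OF assms] Bseq_jackson_weight_0])
qed

subsection \<open>Convergence of the series\<close>

lemma qbinom_bounded: "\<exists>K. \<forall>n k. norm (qbinom q n k) \<le> K"
proof -
  obtain K where K: "\<And>n. norm (qpoch q q n) \<le> K"
    using Bseq_qpoch by (auto simp: Bseq_def)
  obtain L where L: "\<And>n. norm (inverse (qpoch q q n)) \<le> L"
    using Bseq_inverse_qpoch[OF power_q_Suc_neq_1] by (auto simp: Bseq_def)
  have "norm (qbinom q n k) \<le> K * (L * L)" for n k
    unfolding qbinom_def divide_inverse inverse_mult_distrib norm_mult
    using K L by (intro mult_mono) (auto intro: order_trans[OF norm_ge_zero])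
  then show ?thesis by blast
qed

lemma hom_hahn_bound: "\<exists>K. \<forall>n. norm (hom_hahn \<alpha> n a b q) \<le> K * (real n + 1) * max (norm a) (norm b) ^ n"
proof -
  obtain K where K: "\<And>n k. norm (qbinom q n k) \<le> K" using qbinom_bounded by blast
  obtain L where L: "\<And>k. norm (qpoch \<alpha> q k) \<le> L"
    using Bseq_qpoch by (auto simp: Bseq_def)
  have "norm (qbinom q n k * qpoch \<alpha> q k) \<le> K * L" for n k
    unfolding norm_mult using K L by (intro mult_mono) (auto intro: order_trans[OF norm_ge_zero])
  then have "norm (hom_hahn \<alpha> n a b q) \<le> K * L * (real n + 1) * max (norm a) (norm b) ^ n" for n
    unfolding hom_hahn_def by (intro norm_sum_powers_le) auto
  then show ?thesis by blast
qed

text \<open>The denominators \<open>qpoch (c * d * u * v) q k\<close> stay away from 0, because none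
  vanishes and their limit is a nonzero infinite product.\<close>

lemma hahn_W_bound:
  assumes "\<And>k. 1 - c * d * u * v * q ^ k \<noteq> 0"
  shows "\<exists>K. \<forall>n. norm (hahn_W n c d u v q) \<le> K * (real n + 1) * max (norm u) (norm v) ^ n"
proof -
  obtain K where K: "\<And>n k. norm (qbinom q n k) \<le> K" using qbinom_bounded by blast
  have "Bseq (\<lambda>k. qpochs [c * v, d * v] q k / qpoch (c * d * u * v) q k)"
    unfolding divide_inverse qpochs_Cons qpochs_Nil mult_1_right
    by (intro Bseq_mult Bseq_qpoch Bseq_inverse_qpoch assms)
  then obtain L where L: "\<And>k. norm (qpochs [c * v, d * v] q k / qpoch (c * d * u * v) q k) \<le> L"
    unfolding Bseq_def by blast
  have "norm (qbinom q n k * (qpochs [c * v, d * v] q k / qpoch (c * d * u * v) q k)) \<le> K * L" for n k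
    unfolding norm_mult using K L by (intro mult_mono) (auto intro: order_trans[OF norm_ge_zero])
  then have "norm (hahn_W n c d u v q) \<le> K * L * (real n + 1) * max (norm u) (norm v) ^ n" for n
    unfolding hahn_W_def by (intro norm_sum_powers_le) auto
  then show ?thesis by blast
qed

lemma summable_hahn_W_hom_hahn:
  assumes C: "\<And>k. 1 - c * d * u * v * q ^ k \<noteq> 0"
    and small: "norm (a * u) < 1" "norm (a * v) < 1" "norm (b * u) < 1" "norm (b * v) < 1"
  shows "summable (\<lambda>n. hahn_W n c d u v q * hom_hahn \<alpha> n a b q / qpoch q q n)"
proof -
  define A U where "A = max (norm a) (norm b)" and "U = max (norm u) (norm v)"
  obtain K where K: "\<And>n. norm (hahn_W n c d u v q) \<le> K * (real n + 1) * U ^ n"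
    using hahn_W_bound[OF C] unfolding U_def by blast
  obtain L where L: "\<And>n. norm (hom_hahn \<alpha> n a b q) \<le> L * (real n + 1) * A ^ n"
    using hom_hahn_bound unfolding A_def by blast
  obtain R where R: "\<And>n. norm (inverse (qpoch q q n)) \<le> R"
    using Bseq_inverse_qpoch[OF power_q_Suc_neq_1] by (auto simp: Bseq_def)
  \<comment> \<open>The product of the two maxima is the largest of the four quantities assumed to
    be less than 1.\<close>
  have AU: "0 \<le> U * A" "U * A < 1"
    using small by (auto simp: A_def U_def max_def norm_mult mult.commute)
  show ?thesis
  proof (rule summable_comparison_test')
    show "summable (\<lambda>n. K * L * R * ((real n + 1)\<^sup>2 * (U * A) ^ n))"
      by (intro summable_mult summable_square_geometric AU)
    show "norm (hahn_W n c d u v q * hom_hahn \<alpha> n a b q / qpoch q q n) \<le>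
        K * L * R * ((real n + 1)\<^sup>2 * (U * A) ^ n)" for n
    proof -
      have "norm (hahn_W n c d u v q * hom_hahn \<alpha> n a b q / qpoch q q n) \<le>
          (K * (real n + 1) * U ^ n) * (L * (real n + 1) * A ^ n) * R"
        unfolding divide_inverse norm_mult
        by (intro mult_mono K L R) (auto intro: order_trans[OF norm_ge_zero] K L R mult_nonneg_nonneg)
      then show ?thesis by (simp add: power2_eq_square power_mult_distrib mult_ac)
    qed
  qed
qed

subsection \<open>Analytic continuation in the scaling parameter\<close>

lemma Bseq_hahn_weight:
  "Bseq (\<lambda>k. qpoch_inf (\<alpha> * a * (z * q ^ k)) q / qpochs_inf [a * (z * q ^ k), b * (z * q ^ k)] q *
    jackson_weight u v c d q (z * q ^ k))"
proof (rule convergent_imp_Bseq[OF convergentI])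
  show "(\<lambda>k. qpoch_inf (\<alpha> * a * (z * q ^ k)) q / qpochs_inf [a * (z * q ^ k), b * (z * q ^ k)] q *
    jackson_weight u v c d q (z * q ^ k)) \<longlonglongrightarrow>
    qpoch_inf (\<alpha> * a * 0) q / qpochs_inf [a * 0, b * 0] q * 1"
    unfolding qpochs_inf_Cons qpochs_inf_Nil
    by (intro tendsto_intros tendsto_qpoch_inf jackson_weight_tendsto_1 node_tendsto_0)
      (use qpoch_inf_0 in simp)
qed

text \<open>Multiplying the Jackson sum for \<open>(as, bs)\<close> by \<open>(asz, bsz; q)\<^sub>\<infinity>\<close>
  clears the denominators and makes it entire in \<open>s\<close>.\<close>

definition cleared_sum ::
    "complex \<Rightarrow> complex \<Rightarrow> complex \<Rightarrow> (complex \<Rightarrow> complex) \<Rightarrow> complex \<Rightarrow> complex \<Rightarrow> complex" where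
  "cleared_sum \<alpha> a b w z s = (\<Sum>k. z * q ^ k * (qpoch_inf (\<alpha> * a * s * (z * q ^ k)) q *
     (qpoch (a * s * z) q k * qpoch (b * s * z) q k) * w (z * q ^ k)))"

text \<open>At the node \<open>z * q ^ k\<close> the quotient of \<open>qpoch_inf e q\<close> by
  \<open>qpoch_inf (e * q ^ k) q\<close> is the finite product \<open>qpoch e q k\<close>, for
  \<open>e = a * s * z\<close> and \<open>e = b * s * z\<close>.\<close>

lemma cleared_sum_eq:
  assumes "\<And>k. 1 - a * s * z * q ^ k \<noteq> 0" "\<And>k. 1 - b * s * z * q ^ k \<noteq> 0"
  shows "cleared_sum \<alpha> a b (jackson_weight u v c d q) z s =
    qpochs_inf [a * s * z, b * s * z] q *
    jackson_sum q z (\<lambda>x. qpoch_inf (\<alpha> * (a * s) * x) q / qpochs_inf [a * s * x, b * s * x] q *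
      jackson_weight u v c d q x)"
proof -
  let ?f = "\<lambda>x. qpoch_inf (\<alpha> * (a * s) * x) q / qpochs_inf [a * s * x, b * s * x] q *
      jackson_weight u v c d q x"
  have *: "qpoch e q k = qpoch_inf e q * inverse (qpoch_inf (e * q ^ k) q)"
    if "\<And>k. 1 - e * q ^ k \<noteq> 0" for e k
  proof -
    have "1 - e * q ^ k * q ^ j \<noteq> 0" for j
      using that[of "k + j"] by (simp add: power_add mult.assoc)
    then have "qpoch_inf (e * q ^ k) q \<noteq> 0" by (rule qpoch_inf_nonzero)
    then show ?thesis using qpoch_inf_split[of e k] by simp
  qed
  have "(\<lambda>k. qpochs_inf [a * s * z, b * s * z] q * (z * q ^ k * ?f (z * q ^ k))) sums
      (qpochs_inf [a * s * z, b * s * z] q * jackson_sum q z ?f)"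
    by (intro sums_mult jackson_sum_sums Bseq_hahn_weight)
  moreover have "qpochs_inf [a * s * z, b * s * z] q * (z * q ^ k * ?f (z * q ^ k)) =
      z * q ^ k * (qpoch_inf (\<alpha> * a * s * (z * q ^ k)) q *
     (qpoch (a * s * z) q k * qpoch (b * s * z) q k) * jackson_weight u v c d q (z * q ^ k))" for k
    unfolding *[OF assms(1)] *[OF assms(2)]
    by (simp add: divide_inverse mult_ac)
  ultimately show ?thesis
    by (simp add: sums_iff cleared_sum_def)
qed

text \<open>Each term is entire in \<open>s\<close>, and the Weierstrass test gives uniform
  convergence on closed discs of radius 1.\<close>

lemma cleared_sum_holomorphic:
  assumes "Bseq (\<lambda>k. w (z * q ^ k))"
  shows "cleared_sum \<alpha> a b w z holomorphic_on UNIV"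
proof (rule holomorphic_uniform_sequence)
  obtain L where L: "\<And>k. norm (w (z * q ^ k)) \<le> L"
    using assms by (auto simp: Bseq_def)
  define g where "g k s = z * q ^ k * (qpoch_inf (\<alpha> * a * s * (z * q ^ k)) q *
     (qpoch (a * s * z) q k * qpoch (b * s * z) q k) * w (z * q ^ k))" for k s
  show "(\<lambda>s. \<Sum>k<n. g k s) holomorphic_on UNIV" for n
    unfolding g_def qpoch_def by (intro holomorphic_intros holomorphic_on_qpoch_inf)
  fix s0 :: complex
  \<comment> \<open>\<open>E e\<close> bounds every finite or infinite product with first argument
    \<open>e * s * z\<close>, for all \<open>s\<close> within distance 1 of
    \<open>s0\<close>.\<close>
  define E where "E e = exp (norm e * norm z * (norm s0 + 1) / (1 - norm q))" for e :: complex
  have E: "norm (e * s * z) \<le> norm e * norm z * (norm s0 + 1)" if "s \<in> cball s0 1" for e s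
  proof -
    have "norm s \<le> norm s0 + 1"
      using that norm_triangle_ineq2[of s s0] by (simp add: dist_norm norm_minus_commute)
    from mult_left_mono[OF this, of "norm e * norm z"] show ?thesis
      by (simp add: norm_mult mult_ac)
  qed
  have "uniform_limit (cball s0 1) (\<lambda>n s. \<Sum>k<n. g k s) (\<lambda>s. \<Sum>k. g k s) sequentially"
  proof (rule Weierstrass_m_test)
    show "summable (\<lambda>k. norm z * (E (\<alpha> * a) * (E a * E b) * L) * norm q ^ k)"
      using q by (intro summable_mult summable_geometric) auto
    show "norm (g k s) \<le> norm z * (E (\<alpha> * a) * (E a * E b) * L) * norm q ^ k"
      if s: "s \<in> cball s0 1" for k s
    proof -
      have "norm (\<alpha> * a * s * (z * q ^ k)) \<le> norm (\<alpha> * a * s * z)"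
        using q mult_left_mono[of "norm (q ^ k)" 1 "norm (\<alpha> * a * s * z)"]
        by (simp add: norm_mult norm_power power_le_one mult.assoc)
      then have "norm (qpoch_inf (\<alpha> * a * s * (z * q ^ k)) q) \<le> E (\<alpha> * a)"
        unfolding E_def by (intro norm_qpoch_inf_le order_trans[OF _ E[OF s]])
      then have "norm (qpoch_inf (\<alpha> * a * s * (z * q ^ k)) q *
          (qpoch (a * s * z) q k * qpoch (b * s * z) q k) * w (z * q ^ k)) \<le> E (\<alpha> * a) * (E a * E b) * L"
        unfolding norm_mult E_def using norm_qpoch_le[OF E[OF s]] L
        by (intro mult_mono) auto
      from mult_left_mono[OF this, of "norm (z * q ^ k)"] show ?thesis
        by (simp add: g_def norm_mult norm_power mult_ac)
    qed
  qed
  then show "\<exists>d>0. cball s0 d \<subseteq> UNIV \<and>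
      uniform_limit (cball s0 d) (\<lambda>n s. \<Sum>k<n. g k s) (cleared_sum \<alpha> a b w z) sequentially"
    unfolding cleared_sum_def[abs_def] g_def by (intro exI[of _ 1]) auto
qed auto

text \<open>Termwise integration of the generating function replaces \<open>x ^ n\<close> by the
  \<open>n\<close>-th moment, which is \<open>hahn_W n\<close> times the zeroth.\<close>

lemma jackson_hom_hahn_small:
  fixes c d u v \<alpha> a b :: complex
  defines "w \<equiv> jackson_weight u v c d q"
  assumes nz: "\<And>z k. z \<in> {u, v} \<Longrightarrow> 1 - c * z * q ^ k \<noteq> 0 \<and> 1 - d * z * q ^ k \<noteq> 0"
    and uv: "u \<noteq> 0" "v \<noteq> 0" and C: "\<And>k. 1 - c * d * u * v * q ^ k \<noteq> 0"
    and small: "norm (a * u) < 1" "norm (a * v) < 1" "norm (b * u) < 1" "norm (b * v) < 1"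
  shows "(\<lambda>n. jackson_moment u v c d q 0 * (hahn_W n c d u v q * hom_hahn \<alpha> n a b q / qpoch q q n)) sums
    (jackson_sum q v (\<lambda>x. qpoch_inf (\<alpha> * a * x) q / qpochs_inf [a * x, b * x] q * w x) -
     jackson_sum q u (\<lambda>x. qpoch_inf (\<alpha> * a * x) q / qpochs_inf [a * x, b * x] q * w x))"
proof -
  have "(\<lambda>n. hom_hahn \<alpha> n a b q / qpoch q q n * jackson_sum q v (\<lambda>x. x ^ n * w x) -
      hom_hahn \<alpha> n a b q / qpoch q q n * jackson_sum q u (\<lambda>x. x ^ n * w x)) sums
    (jackson_sum q v (\<lambda>x. qpoch_inf (\<alpha> * a * x) q / qpochs_inf [a * x, b * x] q * w x) -
     jackson_sum q u (\<lambda>x. qpoch_inf (\<alpha> * a * x) q / qpochs_inf [a * x, b * x] q * w x))"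
    unfolding w_def by (intro sums_diff jackson_sum_hom_hahn small)
  moreover have "hom_hahn \<alpha> n a b q / qpoch q q n * jackson_sum q v (\<lambda>x. x ^ n * w x) -
      hom_hahn \<alpha> n a b q / qpoch q q n * jackson_sum q u (\<lambda>x. x ^ n * w x) =
      jackson_moment u v c d q 0 * (hahn_W n c d u v q * hom_hahn \<alpha> n a b q / qpoch q q n)" for n
  proof -
    have "jackson_sum q v (\<lambda>x. x ^ n * w x) - jackson_sum q u (\<lambda>x. x ^ n * w x) =
        hahn_W n c d u v q * jackson_moment u v c d q 0"
    proof -
      have "jackson_moment u v c d q n = hahn_W n c d u v q * jackson_moment u v c d q 0"
        by (rule jackson_moment_eq_hahn_W) (use nz uv C in auto)
      then show ?thesis by (simp only: jackson_moment_def[of u v c d q n] w_def)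
    qed
    then show ?thesis
      by (simp only: right_diff_distrib[symmetric]) (simp add: mult_ac)
  qed
  ultimately show ?thesis by simp
qed

text \<open>Here the series is only assumed to converge, so the identity is carried from small
  \<open>s\<close> through the unit disc and reaches \<open>s = 1\<close> as a radial limit.\<close>

lemma jackson_hom_hahn:
  fixes c d u v \<alpha> a b :: complex
  defines "f \<equiv> \<lambda>x. qpoch_inf (\<alpha> * a * x) q / qpochs_inf [a * x, b * x] q * jackson_weight u v c d q x"
    and "t \<equiv> \<lambda>n. hahn_W n c d u v q * hom_hahn \<alpha> n a b q / qpoch q q n"
  assumes nz: "\<And>z k. z \<in> {u, v} \<Longrightarrow> 1 - c * z * q ^ k \<noteq> 0 \<and> 1 - d * z * q ^ k \<noteq> 0"
    and nz': "\<And>z k. z \<in> {u, v} \<Longrightarrow> 1 - a * z * q ^ k \<noteq> 0 \<and> 1 - b * z * q ^ k \<noteq> 0"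
    and uv: "u \<noteq> 0" "v \<noteq> 0" and C: "\<And>k. 1 - c * d * u * v * q ^ k \<noteq> 0"
    and t: "summable t"
  shows "jackson_sum q v f - jackson_sum q u f = jackson_moment u v c d q 0 * suminf t"
proof -
  define w where "w = jackson_weight u v c d q"
  define M where "M = jackson_moment u v c d q 0"
  define T where "T s = (\<Sum>n. t n * s ^ n)" for s
  define P where "P z s = qpochs_inf [a * s * z, b * s * z] q" for z s
  define G where "G = cleared_sum \<alpha> a b w"
  \<comment> \<open>The difference of the two sides for \<open>(a * s, b * s)\<close>, multiplied by
    \<open>P u s * P v s\<close>. Cleared in this way it has no poles in the disc.\<close>
  define F where "F s = P u s * G v s - P v s * G u s - M * P u s * P v s * T s" for s
  have Bw: "Bseq (\<lambda>k. w (z * q ^ k))" for z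
    unfolding w_def by (rule Bseq_jackson_weight_0)
  have st: "summable (\<lambda>n. t n * s ^ n)" if "norm s < 1" for s
    using powser_inside[of t 1 s] t that by simp
  have G_hol: "G z holomorphic_on UNIV" for z
    unfolding G_def by (intro cleared_sum_holomorphic Bw)
  have P_hol: "P z holomorphic_on UNIV" for z
    unfolding P_def qpochs_inf_Cons qpochs_inf_Nil
    by (intro holomorphic_intros holomorphic_on_qpoch_inf)
  have T_hol: "T holomorphic_on ball 0 1"
    by (rule power_series_holomorphic[of _ _ t]) (auto simp: T_def intro!: summable_sums st)
  have F_hol: "F holomorphic_on ball 0 1"
    unfolding F_def
    by (intro holomorphic_intros T_hol holomorphic_on_subset[OF G_hol] holomorphic_on_subset[OF P_hol]) auto
  \<comment> \<open>Writing \<open>S\<close> for the sum of the four norms,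
    \<open>S * r = 1 - r\<close>, so the scaled parameters satisfy the smallness conditions for
    \<open>norm s < r\<close>.\<close>
  define r where "r = 1 / (1 + norm (a * u) + norm (a * v) + norm (b * u) + norm (b * v))"
  have r: "0 < r" "r \<le> 1"
    by (auto simp: r_def add_pos_nonneg divide_simps)
  have F_small: "F s = 0" if s: "s \<in> ball 0 r" for s
  proof -
    have s1: "norm s < 1" using s r by simp
    have small: "norm (e * s * z) < 1" if "norm (e * z) \<le> norm (a * u) + norm (a * v) + norm (b * u) + norm (b * v)" for e z
    proof -
      have "norm (e * s * z) \<le> (norm (a * u) + norm (a * v) + norm (b * u) + norm (b * v)) * norm s"
        using mult_right_mono[OF that, of "norm s"] by (simp add: norm_mult mult_ac)
      also have "\<dots> \<le> (1 / r - 1) * r"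
        using s r by (intro mult_mono) (auto simp: r_def)
      also have "\<dots> < 1" using r by (simp add: left_diff_distrib)
      finally show ?thesis .
    qed
    have sm: "norm (a * s * u) < 1" "norm (a * s * v) < 1" "norm (b * s * u) < 1" "norm (b * s * v) < 1"
      by (intro small; simp)+
    define J where "J z = jackson_sum q z (\<lambda>x. qpoch_inf (\<alpha> * (a * s) * x) q / qpochs_inf [a * s * x, b * s * x] q * w x)" for z
    have "(\<lambda>n. M * (hahn_W n c d u v q * hom_hahn \<alpha> n (a * s) (b * s) q / qpoch q q n)) sums (J v - J u)"
      unfolding M_def J_def w_def by (rule jackson_hom_hahn_small) (use nz uv C sm in auto)
    moreover have "M * (hahn_W n c d u v q * hom_hahn \<alpha> n (a * s) (b * s) q / qpoch q q n) = M * (t n * s ^ n)" for n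
      by (simp add: hom_hahn_scale t_def mult_ac)
    moreover have "(\<lambda>n. M * (t n * s ^ n)) sums (M * T s)"
      unfolding T_def by (intro sums_mult summable_sums st s1)
    ultimately have J: "J v - J u = M * T s"
      by (simp add: sums_unique2)
    have G: "G z s = P z s * J z" if "z \<in> {u, v}" for z
      unfolding G_def P_def J_def w_def
      by (rule cleared_sum_eq; rule factor_nonzero_if_small) (use that sm in auto)
    have "F s = P u s * P v s * (J v - J u) - M * P u s * P v s * T s"
      unfolding F_def by (simp add: G algebra_simps)
    then show ?thesis by (simp add: J)
  qed
  have F_0: "F s = 0" if "s \<in> ball 0 1" for s
    by (rule analytic_continuation_open[of "ball 0 r" "ball 0 1" F "\<lambda>_. 0"])
      (use r F_small F_hol that in auto)
  have of_real_lim: "((\<lambda>x. complex_of_real x) \<longlongrightarrow> 1) (at_left 1)"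
    by (auto intro!: tendsto_eq_intros)
  have lim: "((\<lambda>x. h (complex_of_real x)) \<longlongrightarrow> h 1) (at_left 1)" if "h holomorphic_on UNIV" for h :: "complex \<Rightarrow> complex"
    by (rule isCont_tendsto_compose[OF _ of_real_lim])
      (use holomorphic_on_imp_continuous_on[OF that] in \<open>simp add: continuous_on_eq_continuous_at\<close>)
  \<comment> \<open>The factors \<open>P\<close> and \<open>G\<close> are entire, hence continuous
    at 1; only \<open>T\<close> requires Abel's theorem.\<close>
  have "((\<lambda>x. F (complex_of_real x)) \<longlongrightarrow> P u 1 * G v 1 - P v 1 * G u 1 - M * P u 1 * P v 1 * suminf t) (at_left 1)"
    unfolding F_def using Abel_limit[OF t]
    by (intro tendsto_intros lim G_hol P_hol) (simp add: T_def)
  moreover have "((\<lambda>x. F (complex_of_real x)) \<longlongrightarrow> 0) (at_left 1)"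
  proof (rule Lim_transform_eventually[OF tendsto_const])
    show "\<forall>\<^sub>F x in at_left 1. 0 = F (complex_of_real x)"
      using eventually_at_left_real[of 0 "1::real"] F_0 by (auto elim!: eventually_mono)
  qed
  ultimately have "P u 1 * G v 1 - P v 1 * G u 1 - M * P u 1 * P v 1 * suminf t = 0"
    using tendsto_unique[OF trivial_limit_at_left_real] by blast
  moreover have "G z 1 = P z 1 * jackson_sum q z f" if "z \<in> {u, v}" for z
    using cleared_sum_eq[of a 1 z b \<alpha> u v c d] nz'[OF that]
    unfolding G_def P_def f_def w_def by simp
  \<comment> \<open>The clearing factors can be divided out at \<open>s = 1\<close> by
    \<open>nz'\<close>.\<close>
  moreover have "P z 1 \<noteq> 0" if "z \<in> {u, v}" for z
    unfolding P_def using nz'[OF that] qpoch_inf_nonzero by simp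
  ultimately have "P u 1 * P v 1 * (jackson_sum q v f - jackson_sum q u f - M * suminf t) = 0"
    and "P u 1 * P v 1 \<noteq> 0"
    by (simp_all add: algebra_simps)
  then show ?thesis by (simp add: M_def)
qed

section \<open>The identity for the Jackson integral\<close>

lemma jackson_integral_eq_sums:
  assumes "\<And>z. z \<in> {u, v} \<Longrightarrow> Bseq (\<lambda>k. f (z * q ^ k))"
  shows "jackson_integral q u v f = (1 - q) * (jackson_sum q v f - jackson_sum q u f)"
proof -
  have "(\<lambda>n. v * q ^ n * f (v * q ^ n) - u * q ^ n * f (u * q ^ n)) sums
      (jackson_sum q v f - jackson_sum q u f)"
    by (intro sums_diff jackson_sum_sums assms) auto
  then have "(\<Sum>n. (v * f (v * q ^ n) - u * f (u * q ^ n)) * q ^ n) = jackson_sum q v f - jackson_sum q u f"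
    by (simp add: sums_iff algebra_simps)
  then show ?thesis by (simp add: jackson_integral_def)
qed

end

text \<open>Convergence of the series is stated separately from its value: smallness of the four
  products is a sufficient condition, while the identity holds whenever the series
  converges.\<close>

theorem theorem4p4:
  fixes q a b c d u v \<alpha> :: complex
  assumes q: "norm q < 1"
    and uv: "u \<noteq> 0" "v \<noteq> 0"
    and denom: "\<And>x k. x \<in> jackson_nodes q u v \<Longrightarrow>
        1 - a * x * q ^ k \<noteq> 0 \<and> 1 - b * x * q ^ k \<noteq> 0 \<and>
        1 - c * x * q ^ k \<noteq> 0 \<and> 1 - d * x * q ^ k \<noteq> 0"
    and W_denom: "\<And>k. 1 - c * d * u * v * q ^ k \<noteq> 0"
  shows "let t = (\<lambda>n. hahn_W n c d u v q * hom_hahn \<alpha> n a b q / qpoch q q n) in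
      (norm (a * u) < 1 \<and> norm (a * v) < 1 \<and> norm (b * u) < 1 \<and> norm (b * v) < 1
         \<longrightarrow> summable t) \<and>
      (summable t \<longrightarrow>
         jackson_integral q u v
           (\<lambda>x. qpochs_inf [q * x / u, q * x / v, \<alpha> * a * x] q
                / qpochs_inf [a * x, b * x, c * x, d * x] q)
         = (1 - q) * v * qpochs_inf [q, u / v, q * v / u, c * d * u * v] q
             / qpochs_inf [c * u, c * v, d * u, d * v] q
           * (\<Sum>n. t n))"
proof -
  define t where "t n = hahn_W n c d u v q * hom_hahn \<alpha> n a b q / qpoch q q n" for n
  define f where "f x = qpoch_inf (\<alpha> * a * x) q / qpochs_inf [a * x, b * x] q * jackson_weight u v c d q x" for x
  have "z \<in> jackson_nodes q u v" if "z \<in> {u, v}" for z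
    \<comment> \<open>The endpoints are the nodes with exponent 0; the factors at
      \<open>z * q ^ n\<close> occur among those at \<open>z\<close> with larger exponent.\<close>
    using that rangeI[of "\<lambda>n. z * q ^ n" 0] by (auto simp: jackson_nodes_def)
  then have nz: "1 - a * z * q ^ k \<noteq> 0" "1 - b * z * q ^ k \<noteq> 0" "1 - c * z * q ^ k \<noteq> 0" "1 - d * z * q ^ k \<noteq> 0"
    if "z \<in> {u, v}" for z k
    using denom[of z k] that by blast+
  have "summable t" if "norm (a * u) < 1" "norm (a * v) < 1" "norm (b * u) < 1" "norm (b * v) < 1"
    unfolding t_def using summable_hahn_W_hom_hahn[OF q W_denom that] .
  moreover have "jackson_integral q u v
           (\<lambda>x. qpochs_inf [q * x / u, q * x / v, \<alpha> * a * x] q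
                / qpochs_inf [a * x, b * x, c * x, d * x] q)
         = (1 - q) * v * qpochs_inf [q, u / v, q * v / u, c * d * u * v] q
             / qpochs_inf [c * u, c * v, d * u, d * v] q * suminf t" if "summable t"
  proof -
    have "(\<lambda>x. qpochs_inf [q * x / u, q * x / v, \<alpha> * a * x] q
                / qpochs_inf [a * x, b * x, c * x, d * x] q) = f"
      by (rule ext) (simp add: f_def jackson_weight_def mult_ac)
    moreover have "jackson_integral q u v f = (1 - q) * (jackson_sum q v f - jackson_sum q u f)"
      unfolding f_def by (intro jackson_integral_eq_sums[OF q] Bseq_hahn_weight[OF q])
    moreover have "jackson_sum q v f - jackson_sum q u f = jackson_moment u v c d q 0 * suminf t"
      unfolding f_def t_def by (rule jackson_hom_hahn[OF q]) (use nz uv W_denom that in \<open>auto simp: t_def[abs_def]\<close>)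
    moreover have "jackson_moment u v c d q 0 =
        v * qpochs_inf [q, u / v, q * v / u, c * d * u * v] q / qpochs_inf [c * u, c * v, d * u, d * v] q"
      by (rule andrews_askey[OF q]) (use nz uv in auto)
    ultimately show ?thesis by simp
  qed
  ultimately show ?thesis
    unfolding Let_def t_def by blast
qed

end
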